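(* In the concrete model, for every $1\le j\le M$ and $u\in\mathbb{C}$ one has $T_j(u)T_j(-u)=P_j(u^2)\,\mathbb{1}$, where the polynomials $P_j\in\mathbb{C}[z]$ are given by $P_j=1$ for $j\le 0$ and, for $m\ge 1$, $$P_{2m}(z)=P_{2m-2}(z)-z\,(b_{2m-1}^2+b_{2m}^2+\bar b_{2m+1}^2)\,P_{2m-4}(z)+z^2\,b_{2m-3}^2b_{2m}^2\,(1+\beta_{2m-1}b_{2m-2}^2)^2\,P_{2m-6}(z)-z^2\,b_{2m-5}^2\,\bar b_{2m+1}^2\,P_{2m-8}(z),$$ $$P_{2m-1}(z)=P_{2m-2}(z)-z\,b_{2m-1}^2\,P_{2m-4}(z)$$ (terms whose coefficient contains a vanishing $b_i$ with $i\le0$ are zero).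
   Context: Concrete model. Fix an integer $M\ge1$ and complex numbers $b_1,\dots,b_M$. Let $h_1,\dots,h_M$ be elements of a unital associative complex algebra satisfying $h_m^2=b_m^2\mathbb{1}$, $h_mh_{m+1}=-h_{m+1}h_m$, $h_mh_{m+2}=-h_{m+2}h_m$, and $h_mh_l=h_lh_m$ for $|l-m|>2$ (e.g. $h_m=b_m\sigma^z_m\sigma^z_{m+1}\sigma^x_{m+2}$ on a spin chain). Set $h_j:=0$, $b_j:=0$ for $j\le 0$ or $j>M$. Let $\beta_3,\beta_5$ be arbitrary complex numbers and define $\beta_{2m+1}:=\beta_{2m-1}/(b_{2m-4}^2\beta_{2m-3}-b_{2m}^2\beta_{2m-1}+1)$ for $m\ge3$ (denominators assumed nonzero). For $2\le m\le\lfloor M/2\rfloor$ put $\bar h_{2m+1}:=\beta_{2m-1}h_{2m-2}h_{2m-3}h_{2m}$ and $\bar b_{2m+1}:=\beta_{2m-1}b_{2m-2}b_{2m-3}b_{2m}$ (so $\bar h_{2m+1}^2=\bar b_{2m+1}^2\mathbb{1}$); otherwise $\bar h_{2m+1}:=0$, $\bar b_{2m+1}:=0$. For $1\le j\le M$, the model of size $j$ (same couplings) has frustration graph $G_j$ with vertices $h_1,\dots,h_j$ and $\bar h_{2m+1}$ for $2\le m\le\lfloor j/2\rfloor$, and edges $h_i\sim h_l$ iff $|i-l|\in\{1,2\}$; $\bar h_{2m-1}\sim h_l$ iff $l\in\{2m-7,2m-5,2m-3,2m-1,2m-2,2m\}$; $\bar h_{2m-1}\sim\bar h_{2m'-1}$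 iff $|m-m'|=1$ (adjacent vertices anticommute, non-adjacent distinct ones commute). Charges: $Q_j^{(k)}:=\sum_{S}\prod_{v\in S}v$, the sum over independent sets $S$ of $G_j$ of size $k$ ($Q_j^{(0)}=\mathbb{1}$). Hamiltonian $H_j:=Q_j^{(1)}=\sum_{l=1}^j h_l+\sum_{m=2}^{\lfloor j/2\rfloor}\beta_{2m-1}h_{2m-2}h_{2m-3}h_{2m}$. Transfer matrix $T_j(u):=\sum_{k\ge0}(-u)^kQ_j^{(k)}$ for $u\in\mathbb{C}$, with $T_j(u):=\mathbb{1}$ for $j\le 0$. *)

theory Defs
  imports "HOL-Computational_Algebra.Polynomial" "HOL-Library.Product_Lexorder"
begin

definition ext_b :: "nat \<Rightarrow> (nat \<Rightarrow> complex) \<Rightarrow> int \<Rightarrow> complex" where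
  "ext_b M b i = (if 1 \<le> i \<and> i \<le> int M then b (nat i) else 0)"

definition ext_h :: "nat \<Rightarrow> (nat \<Rightarrow> 'a::ring_1) \<Rightarrow> int \<Rightarrow> 'a" where
  "ext_h M h i = (if 1 \<le> i \<and> i \<le> int M then h (nat i) else 0)"

text \<open>beta_seq bb b3 b5 m = beta_{2m+1} (m >= 1); the value at m = 0 is an unused dummy.\<close>
fun beta_seq :: "(int \<Rightarrow> complex) \<Rightarrow> complex \<Rightarrow> complex \<Rightarrow> nat \<Rightarrow> complex" where
  "beta_seq bb b3 b5 0 = 0"
| "beta_seq bb b3 b5 (Suc 0) = b3"
| "beta_seq bb b3 b5 (Suc (Suc 0)) = b5"
| "beta_seq bb b3 b5 (Suc (Suc (Suc n))) =
     (let m = int n + 3 in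
        beta_seq bb b3 b5 (n + 2) /
        ((bb (2 * m - 4))\<^sup>2 * beta_seq bb b3 b5 (n + 1)
          - (bb (2 * m))\<^sup>2 * beta_seq bb b3 b5 (n + 2) + 1))"

definition beta_odd :: "(int \<Rightarrow> complex) \<Rightarrow> complex \<Rightarrow> complex \<Rightarrow> int \<Rightarrow> complex" where
  "beta_odd bb b3 b5 k = beta_seq bb b3 b5 (nat (k div 2))"

definition bar_b :: "nat \<Rightarrow> (int \<Rightarrow> complex) \<Rightarrow> complex \<Rightarrow> complex \<Rightarrow> int \<Rightarrow> complex" where
  "bar_b M bb b3 b5 n =
     (if odd n \<and> 2 \<le> (n - 1) div 2 \<and> (n - 1) div 2 \<le> int M div 2
      then beta_odd bb b3 b5 (n - 2) * bb (n - 3) * bb (n - 4) * bb (n - 1) else 0)"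

text \<open>Vertices of the frustration graph G_j: (l, False) stands for h_l,
  (n, True) stands for bar h_n with n = 2m+1.\<close>
definition vertices :: "nat \<Rightarrow> (int \<times> bool) set" where
  "vertices j = {(l, False) | l. 1 \<le> l \<and> l \<le> int j}
              \<union> {(2 * m + 1, True) | m. 2 \<le> m \<and> m \<le> int j div 2}"

definition adjacent :: "int \<times> bool \<Rightarrow> int \<times> bool \<Rightarrow> bool" where
  "adjacent x y = (case (x, y) of
       ((i, False), (l, False)) \<Rightarrow> \<bar>i - l\<bar> \<in> {1, 2}
     | ((n, True), (l, False)) \<Rightarrow> l \<in> {n - 6, n - 4, n - 2, n, n - 1, n + 1}
     | ((l, False), (n, True)) \<Rightarrow> l \<in> {n - 6, n - 4, n - 2, n, n - 1, n + 1}
     | ((n, True), (n', True)) \<Rightarrow> \<bar>n - n'\<bar> = 2)"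

definition independent :: "(int \<times> bool) set \<Rightarrow> bool" where
  "independent S = (\<forall>x\<in>S. \<forall>y\<in>S. \<not> adjacent x y)"

definition vertex_op :: "(complex \<Rightarrow> 'a::ring_1) \<Rightarrow> nat \<Rightarrow> (nat \<Rightarrow> 'a) \<Rightarrow> (nat \<Rightarrow> complex)
    \<Rightarrow> complex \<Rightarrow> complex \<Rightarrow> int \<times> bool \<Rightarrow> 'a" where
  "vertex_op emb M h b b3 b5 v = (case v of
       (l, False) \<Rightarrow> ext_h M h l
     | (n, True) \<Rightarrow> emb (beta_odd (ext_b M b) b3 b5 (n - 2))
                    * ext_h M h (n - 3) * ext_h M h (n - 4) * ext_h M h (n - 1))"

text \<open>Conserved charges Q_j^(k): sum over independent sets of size k of G_j of the
  product of their vertices (taken in a fixed order; they pairwise commute).\<close>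
definition Q :: "(complex \<Rightarrow> 'a::ring_1) \<Rightarrow> nat \<Rightarrow> (nat \<Rightarrow> 'a) \<Rightarrow> (nat \<Rightarrow> complex)
    \<Rightarrow> complex \<Rightarrow> complex \<Rightarrow> nat \<Rightarrow> nat \<Rightarrow> 'a" where
  "Q emb M h b b3 b5 j k =
     (\<Sum>S \<in> {S. S \<subseteq> vertices j \<and> independent S \<and> card S = k}.
        prod_list (map (vertex_op emb M h b b3 b5) (sorted_list_of_set S)))"

text \<open>Transfer matrix T_j(u) = sum_k (-u)^k Q_j^(k) (finite: Q vanishes beyond card of vertices).\<close>
definition T :: "(complex \<Rightarrow> 'a::ring_1) \<Rightarrow> nat \<Rightarrow> (nat \<Rightarrow> 'a) \<Rightarrow> (nat \<Rightarrow> complex)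
    \<Rightarrow> complex \<Rightarrow> complex \<Rightarrow> nat \<Rightarrow> complex \<Rightarrow> 'a" where
  "T emb M h b b3 b5 j u =
     (\<Sum>k \<le> card (vertices j). emb ((- u) ^ k) * Q emb M h b b3 b5 j k)"

text \<open>The polynomials P_j; P_j = 1 for j <= 0, which is realised by index 0 and
  truncated natural-number subtraction.\<close>
function Ppoly :: "nat \<Rightarrow> (nat \<Rightarrow> complex) \<Rightarrow> complex \<Rightarrow> complex \<Rightarrow> nat \<Rightarrow> complex poly" where
  "Ppoly M b b3 b5 j =
     (if j = 0 then 1
      else if even j then
        Ppoly M b b3 b5 (j - 2)
        - [:0, 1:] * smult ((ext_b M b (int j - 1))\<^sup>2 + (ext_b M b (int j))\<^sup>2
                              + (bar_b M (ext_b M b) b3 b5 (int j + 1))\<^sup>2) (Ppoly M b b3 b5 (j - 4))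
        + [:0, 1:] ^ 2 * smult ((ext_b M b (int j - 3))\<^sup>2 * (ext_b M b (int j))\<^sup>2
                 * (1 + beta_odd (ext_b M b) b3 b5 (int j - 1) * (ext_b M b (int j - 2))\<^sup>2)\<^sup>2)
                 (Ppoly M b b3 b5 (j - 6))
        - [:0, 1:] ^ 2 * smult ((ext_b M b (int j - 5))\<^sup>2 * (bar_b M (ext_b M b) b3 b5 (int j + 1))\<^sup>2)
                 (Ppoly M b b3 b5 (j - 8))
      else
        Ppoly M b b3 b5 (j - 1) - [:0, 1:] * smult ((ext_b M b (int j))\<^sup>2) (Ppoly M b b3 b5 (j - 3)))"
  by pat_completeness auto
termination
  by (relation "measure (\<lambda>(M, b, b3, b5, j). j)") auto

end

theory Submission
  imports Defs
begin

text \<open>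
  Write \<open>t\<close> for the transfer matrix and \<open>tb\<close> for the transfer matrix with \<open>u\<close> replaced by \<open>-u\<close>.
  Deleting the last vertices of the frustration graph gives a recursion that expresses \<open>t\<^sub>2\<^sub>m\<close> through
  \<open>t\<^sub>2\<^sub>m\<^sub>-\<^sub>2\<close>, \<open>t\<^sub>2\<^sub>m\<^sub>-\<^sub>4\<close>, \<open>t\<^sub>2\<^sub>m\<^sub>-\<^sub>6\<close>, \<open>t\<^sub>2\<^sub>m\<^sub>-\<^sub>8\<close> with operator coefficients.
  Multiplying the recursions for \<open>t\<close> and \<open>tb\<close>, the diagonal terms are the recursion for \<open>P\<close>. The cross
  terms cancel by bilinear exchange identities, the basic one being
  \<open>t\<^sub>2\<^sub>m tb\<^sub>2\<^sub>m\<^sub>-\<^sub>2 + t\<^sub>2\<^sub>m\<^sub>-\<^sub>2 tb\<^sub>2\<^sub>m = 2 t\<^sub>2\<^sub>m\<^sub>-\<^sub>2 tb\<^sub>2\<^sub>m\<^sub>-\<^sub>2\<close>: an operator that anticommutes with the new letters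
  of \<open>t\<^sub>2\<^sub>m\<close> and commutes with \<open>t\<^sub>2\<^sub>m\<^sub>-\<^sub>2\<close> conjugates \<open>t\<^sub>2\<^sub>m\<close> into \<open>2 t\<^sub>2\<^sub>m\<^sub>-\<^sub>2 - t\<^sub>2\<^sub>m\<close>. These identities are proved by
  a simultaneous induction. To keep scalars out of the algebra, the factor \<open>-u\<close> is absorbed into the
  letters; the barred letter is then \<open>\<beta> / u\<^sup>2\<close> times a product of three of them.
\<close>

section \<open>Exchange identities for one step of the recursion\<close>

text \<open>Lets an exchange rule for two factors fire inside a product associated to the
  right.\<close>

lemma rewrite_prefix: "x * y = w \<Longrightarrow> x * (y * z) = w * z" for x y z w :: "'a::semigroup_mult"
  by (metis mult.assoc)

text \<open>
  At level \<open>m\<close>, with \<open>-u\<close> absorbed: \<open>c\<close>, \<open>a\<close>, \<open>c1\<close>, \<open>a1\<close>, \<open>a2\<close> are the letters \<open>h\<close> of index \<open>2m\<close>, \<open>2m-1\<close>,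
  \<open>2m-2\<close>, \<open>2m-3\<close>, \<open>2m-5\<close>, and \<open>d\<close> is the barred letter of index \<open>2m+1\<close>. \<open>T\<close>, \<open>S\<close>, \<open>S1\<close>, \<open>S2\<close> are the transfer
  matrices of size \<open>2m-2\<close>, \<open>2m-4\<close>, \<open>2m-6\<close>, \<open>2m-8\<close>; \<open>X\<close> and \<open>W\<close> are \<open>T\<close> and \<open>S\<close> with the letters \<open>a1\<close> and \<open>a2\<close>
  deleted, and \<open>Y\<close> is the transfer matrix of size \<open>2m-3\<close> with its last coupling rescaled by \<open>k\<close>. The
  suffix \<open>b\<close> marks the counterparts for \<open>-u\<close>.
\<close>

locale transfer_step =
  fixes a c a1 a2 c1 g T S S1 S2 X W Tb Sb S1b S2b Xb Wb d k Y Yb :: "'a::ring_1"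
  assumes ca: "c * a = - (a * c)" and cc1: "c * c1 = - (c1 * c)" and ca1: "c * a1 = a1 * c"
    and c1a1: "c1 * a1 = - (a1 * c1)" and c1a: "c1 * a = - (a * c1)" and a1a: "a1 * a = - (a * a1)"
    and ca2: "c * a2 = a2 * c" and c1a2: "c1 * a2 = a2 * c1" and a1a2: "a1 * a2 = - (a2 * a1)"
    and Sa: "S * a = a * S" and Sc: "S * c = c * S" and S1c: "S1 * c = c * S1"
    and S1a: "S1 * a = a * S1" and S1a1: "S1 * a1 = a1 * S1" and S1c1: "S1 * c1 = c1 * S1"
    and S2a1: "S2 * a1 = a1 * S2" and S2c1: "S2 * c1 = c1 * S2" and S2c: "S2 * c = c * S2" and S2a2: "S2 * a2 = a2 * S2"
    and Wa: "W * a = a * W" and Wc: "W * c = c * W"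
    and Xa: "X * a = a * (S + S - X)" and Xc: "X * c = c * (S + S - X)"
    and Wa1: "W * a1 = a1 * (S1 + S1 - W)" and Wc1: "W * c1 = c1 * (S1 + S1 - W)"
    and g: "z * g = g * z" and c1sq: "z * (c1 * c1) = c1 * c1 * z"
    and T: "T = X + a1 * S1" and Tb: "Tb = Xb - a1 * S1b"
    and S: "S = W + a2 * S2" and Sb: "Sb = Wb - a2 * S2b"
    and d: "d = g * c1 * a1 * c"
    and k: "k = 1 + g * c1 * c1"
    and Y: "Y = S + k * a1 * S1" and Yb: "Yb = Sb - k * a1 * S1b"
    and X_a1_swap: "X * a1 * S1b = a1 * S1 * Xb" and W_a2_swap: "W * a2 * S2b = a2 * S2 * Wb"
    and X_S_pair: "X * Sb + S * Xb = S * Sb + S * Sb"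
    and T_S_pair: "T * Sb + S * Tb = S * Sb + S * Sb"
    and S_S1_pair: "S * S1b + S1 * Sb = S1 * S1b + S1 * S1b"
    and W_S1_pair: "W * S1b + S1 * Wb = S1 * S1b + S1 * S1b"
    and X_c1_a1_exchange: "c1 * a1 * W * Xb + (X - S - S) * c1 * a1 * Wb = c1 * c1 * (S * a1 * S1b + S * a1 * S1b)"
begin

section \<open>Commutation rules for the new letters\<close>

lemmas ring = distrib_left distrib_right left_diff_distrib right_diff_distrib mult.assoc

lemma g': "z * (g * w) = g * (z * w)" "z * g = g * z"
  using g by (metis mult.assoc)+

lemma k_central: "z * k = k * z"
  using g[of z] c1sq[of z] unfolding k by (simp add: ring) (metis g mult.assoc)

lemma k': "z * (k * w) = k * (z * w)"
  using k_central by (metis mult.assoc)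

lemma aa1: "a1 * (a * z) = - (a * (a1 * z))"
  using a1a by (metis mult.assoc mult_minus_left)

lemma Ta: "T * a = a * (S + S - T)"
  unfolding T by (simp add: ring Xa S1a aa1)

lemma Ya: "Y * a = a * (S + S - Y)"
  unfolding Y by (simp add: ring Sa S1a aa1 k'[of a])

lemma Yc: "Y * c = c * Y"
  unfolding Y by (simp add: ring Sc S1c k'[of c] ca1[THEN rewrite_prefix])

text \<open>Both \<open>c1\<close> and \<open>a1\<close> turn \<open>W\<close> into
  \<open>S1 + S1 - W\<close>. This reflection is an involution, so passing both letters restores
  \<open>W\<close>.\<close>

lemma dW: "W * d = d * W"
proof -
  have "W * (c1 * (a1 * c)) = c1 * (a1 * (c * W))"
    by (simp add: ring Wc1[THEN rewrite_prefix] Wa1[THEN rewrite_prefix] S1a1[THEN rewrite_prefix] S1c Wc)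
  then show ?thesis unfolding d by (simp add: mult.assoc g')
qed

lemma da: "d * a = - (a * d)"
  unfolding d using ca c1a a1a
  by (simp add: mult.assoc g'(1)[of a] c1a[THEN rewrite_prefix] aa1)

lemma dc: "d * c = - (c * d)"
  unfolding d
  by (simp add: mult.assoc g'(1)[of c] cc1[THEN rewrite_prefix] ca1[THEN rewrite_prefix])

lemma d_eq: "d = - (g * c * c1 * a1)"
  unfolding d by (simp add: mult.assoc cc1[THEN rewrite_prefix] ca1)

text \<open>\<open>d\<close> anticommutes with \<open>a2\<close>, through its factor
  \<open>a1\<close> alone, and commutes with \<open>W\<close> and \<open>S2\<close>; so it reverses
  the sign of \<open>a2 * S2\<close> in \<open>S\<close>.\<close>

lemma Sd: "S * d = d * (W + W - S)"
proof -
  have "a2 * d = - (d * a2)"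
    unfolding d
    by (simp add: mult.assoc g'(1)[of a2] c1a2[THEN rewrite_prefix] a1a2[THEN rewrite_prefix] ca2)
  moreover have "S2 * d = d * S2"
    unfolding d
    by (simp add: mult.assoc g'(1)[of S2] S2c1[THEN rewrite_prefix] S2a1[THEN rewrite_prefix] S2c)
  ultimately have "a2 * S2 * d = - (d * (a2 * S2))"
    by (metis mult.assoc mult_minus_left)
  then show ?thesis
    unfolding S by (simp add: distrib_left distrib_right right_diff_distrib dW)
qed

lemma Tc: "T * c = c * (S + S + T - X - X)"
  unfolding T by (simp add: ring Xc S1c ca1[symmetric, THEN rewrite_prefix])

text \<open>Oriented so that \<open>a\<close>, \<open>c\<close>, \<open>d\<close> gather in this
  order to the left of the transfer matrices; identities are then compared in this normal
  form.\<close>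

lemmas moves = Tc ca Sa Sc S1a Xa Xc Wa Wc Ta Ya Yc dW da dc Sd
lemmas moves' = moves moves[THEN rewrite_prefix]

section \<open>Exchange identities at the new level\<close>

lemma T_a_swap: "T * a * Sb = a * S * Tb"
proof -
  have "a * (T * Sb + S * Tb) = a * (S * Sb + S * Sb)" by (simp only: T_S_pair)
  then show ?thesis by (simp add: ring moves' algebra_simps)
qed

lemma X_T_pair: "X * Tb + T * Xb = X * Xb + X * Xb"
  using X_a1_swap unfolding T Tb by (simp add: ring algebra_simps)

lemma W_S_pair: "W * Sb + S * Wb = W * Wb + W * Wb"
  using W_a2_swap unfolding S Sb by (simp add: ring algebra_simps)

lemma Sa1: "S * a1 = a1 * (S1 + S1 - S)"
proof -
  have "a2 * (a1 * S2) = - (a1 * (a2 * S2))" by (metis a1a2 mult.assoc mult_minus_left minus_minus)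
  then show ?thesis unfolding S by (simp add: ring Wa1 S2a1)
qed

lemma S_a1_swap: "S * a1 * S1b = a1 * S1 * Sb"
proof -
  have "a1 * (S * S1b + S1 * Sb) = a1 * (S1 * S1b + S1 * S1b)" by (simp only: S_S1_pair)
  then show ?thesis by (simp add: ring Sa1[THEN rewrite_prefix] algebra_simps)
qed

lemma Y_S_pair: "Y * Sb + S * Yb = S * Sb + S * Sb"
proof -
  have "S * (k * (a1 * S1b)) = k * (S * a1 * S1b)" by (simp add: mult.assoc k'[of S])
  then show ?thesis using S_a1_swap unfolding Y Yb by (simp add: ring algebra_simps)
qed

text \<open>\<open>a\<close> anticommutes with \<open>c\<close> and \<open>d\<close>, so ordering
  the letters leaves \<open>a * c\<close> and \<open>a * d\<close> times the pair identities of
  \<open>Y\<close> and \<open>W\<close> with \<open>S\<close>.\<close>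

lemma hop_cancel: "a * S * (c * Yb + d * Wb) + (c * Y + d * W) * a * Sb = 0"
proof -
  have "a * c * (Y * Sb + S * Yb - S * Sb - S * Sb) = 0" by (simp add: Y_S_pair)
  moreover have "a * d * (W * Sb + S * Wb - W * Wb - W * Wb) = 0" by (simp add: W_S_pair)
  ultimately show ?thesis by (simp add: ring moves' algebra_simps)
qed

text \<open>The transfer matrices of size \<open>2m\<close> without (\<open>x\<close>) and with
  (\<open>t\<close>) the letter \<open>a\<close>. The part of the barred term that contains
  \<open>c1\<close> is absorbed into \<open>Y\<close>, which explains the factor
  \<open>k\<close>.\<close>

definition "x = T + c * Y + d * W"
definition "xb = Tb - c * Yb - d * Wb"
definition "t = x + a * S"
definition "tb = xb - a * Sb"

text \<open>This is \<open>X_a1_swap\<close> one level up.\<close>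

lemma x_a_swap: "x * a * Sb = a * S * xb"
  using hop_cancel T_a_swap unfolding x_def xb_def by (simp add: ring algebra_simps)

text \<open>Collects terms quadratic in \<open>c\<close>, as \<open>d\<close> also contains one
  \<open>c\<close>. \<open>X_c1_a1_exchange\<close> evaluates the terms with \<open>d\<close> and
  produces the factor \<open>g * c1 * c1 = k - 1\<close>; the terms with \<open>c * c\<close> give
  the opposite of the same expression.\<close>

lemma hop_quadratic: "c * c * a * (S * Tb + S * Tb - (S + S - X) * Yb - (S + S - Y) * Xb)
  + a * c * (d * W * Xb - X * d * Wb) = 0"
proof -
  have 1: "d * W * Xb = - (g * c * (c1 * a1 * W * Xb))"
    unfolding d_eq by (simp add: ring)
  have 2: "X * d * Wb = - (g * c * ((S + S - X) * c1 * a1 * Wb))"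
    unfolding d_eq by (simp add: ring g'(1)[of X] Xc[THEN rewrite_prefix])
  have "d * W * Xb - X * d * Wb = - (g * c * (c1 * a1 * W * Xb + (X - S - S) * c1 * a1 * Wb))"
    unfolding 1 2 by (simp add: ring)
  also have "\<dots> = - (c * ((k - 1) * (S * a1 * S1b + S * a1 * S1b)))"
    unfolding X_c1_a1_exchange k by (simp add: ring g'(1)[of c])
  finally have 3: "d * W * Xb - X * d * Wb = - (c * ((k - 1) * (S * a1 * S1b + S * a1 * S1b)))" .
  have kS: "S * (k * z) = k * (S * z)" "X * (k * z) = k * (X * z)" for z
    by (simp_all only: k')
  have 4: "S * Tb + S * Tb - (S + S - X) * Yb - (S + S - Y) * Xb
    = (k - 1) * (S * a1 * S1b + S * a1 * S1b)"
    using X_S_pair arg_cong[OF X_a1_swap, of "(*) k"] unfolding Tb Y Yb by (simp add: ring kS algebra_simps)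
  have "c * c * a * z + a * c * - (c * z) = 0" for z
    by (simp add: mult.assoc ca ca[THEN rewrite_prefix])
  then show ?thesis unfolding 3 4 .
qed

text \<open>This is \<open>X_c1_a1_exchange\<close> one level up. Terms linear in \<open>c\<close>
  cancel by \<open>X_T_pair\<close>, quadratic ones by \<open>hop_quadratic\<close>.\<close>

lemma x_c_a_exchange: "c * a * X * xb + (x - T - T) * c * a * Xb = c * c * (T * a * Sb + T * a * Sb)"
proof -
  have "c * a * (X * Tb + T * Xb - X * Xb - X * Xb) = 0" by (simp add: X_T_pair)
  with hop_quadratic T_a_swap show ?thesis unfolding x_def xb_def by (simp add: ring moves' algebra_simps)
qed

text \<open>Here \<open>h\<close> and \<open>K\<close> play the roles of \<open>g\<close> and \<open>k\<close> at level \<open>m + 1\<close>.\<close>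

lemma shifted_product:
  assumes pair: "x * Tb + T * xb = T * Tb + T * Tb" and K: "K = 1 + h * c * c"
    and h: "\<And>z. z * h = h * z" and csq: "\<And>z. z * (c * c) = c * c * z"
  shows "(T + K * a * S + h * a * c * X) * (Tb - a * Sb - c * Yb - d * Wb)
    = (T + a * S - c * Y - d * W) * (Tb - K * a * Sb + h * a * c * Xb)"
proof -
  have h': "z * (h * w) = h * (z * w)" for z w using h by (metis mult.assoc)
  have K': "z * (K * w) = K * (z * w)" for z w
    unfolding K using h csq by (simp add: ring) (metis mult.assoc)
  \<comment> \<open>The difference of the two products is sorted by degree in \<open>a\<close> and
    \<open>c\<close>, where \<open>d\<close> counts as degree one in \<open>c\<close>.
    \<open>even\<close>, \<open>odd\<close> and \<open>fold\<close> are the groups with a factor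
    \<open>h\<close>, of degrees (1,2), (1,1) and (2,1).\<close>
  have even: "c * c * (T * a * Sb + a * S * Tb)
      - (a * c * X * (c * Yb + d * Wb) - (c * Y + d * W) * a * c * Xb) = 0"
    using hop_quadratic T_a_swap by (simp add: ring moves' algebra_simps)
  have odd: "a * c * X * Tb - T * a * c * Xb = 0"
  proof -
    have "a * c * (X * Tb + T * Xb - X * Xb - X * Xb) = 0" by (simp add: X_T_pair)
    then show ?thesis by (simp add: ring moves' algebra_simps)
  qed
  have fold: "a * c * X * a * Sb + a * S * a * c * Xb = 0"
  proof -
    have "a * a * c * (X * Sb + S * Xb - S * Sb - S * Sb) = 0" by (simp add: X_S_pair)
    then show ?thesis by (simp add: ring moves' algebra_simps)
  qed
  have "(T + K * a * S + h * a * c * X) * (Tb - a * Sb - c * Yb - d * Wb)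
      - (T + a * S - c * Y - d * W) * (Tb - K * a * Sb + h * a * c * Xb)
    = (x * Tb + T * xb - T * Tb - T * Tb)
      + h * (c * c * (T * a * Sb + a * S * Tb)
          - (a * c * X * (c * Yb + d * Wb) - (c * Y + d * W) * a * c * Xb))
      - K * (a * S * (c * Yb + d * Wb) + (c * Y + d * W) * a * Sb)
      + h * (a * c * X * Tb - T * a * c * Xb)
      - h * (a * c * X * a * Sb + a * S * a * c * Xb)"
  proof -
    have Kz: "h * (c * (c * z)) = K * z - z" for z by (simp add: K ring)
    show ?thesis unfolding x_def xb_def
      by (simp add: ring h' K'[of c] K'[of a] K'[of d] K'[of T] K'[of S] K'[of W] K'[of Y] Kz algebra_simps)
  qed
  then show ?thesis by (simp add: pair even odd fold hop_cancel)
qed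

section \<open>The product of the transfer matrices for \<open>u\<close> and
  \<open>-u\<close>\<close>

lemma Y_norm: "Y * Yb = S * Sb - k * k * (a1 * a1) * (S1 * S1b)"
proof -
  have "Y * Yb = S * Sb - k * (S * a1 * S1b) + k * (a1 * S1 * Sb) - k * k * (a1 * S1 * a1 * S1b)"
    unfolding Y Yb by (simp add: ring k'[of S] k'[of a1] k'[of S1])
  then show ?thesis by (simp add: S_a1_swap) (simp add: mult.assoc S1a1[THEN rewrite_prefix])
qed

text \<open>Read off from \<open>S * Sb\<close>, whose cross terms cancel by
  \<open>W_a2_swap\<close>.\<close>

lemma W_norm: "W * Wb = S * Sb + (a2 * a2) * (S2 * S2b)"
  using W_a2_swap unfolding S Sb by (simp add: ring S2a2[THEN rewrite_prefix])

text \<open>With \<open>d\<close> written as \<open>- (g * c * c1 * a1)\<close>, both summands are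
  \<open>g * c * c\<close> times a product, with opposite signs. The products agree because
  conjugation by \<open>c1 * a1\<close> reflects \<open>Y\<close> in \<open>W\<close>, and
  \<open>W\<close> and \<open>Y\<close> satisfy a pair identity.\<close>

lemma cross_cancel: "c * Y * d * Wb + d * W * c * Yb = 0"
proof -
  have "W * (a1 * S1b) = a1 * (S1 * S1b + S1 * S1b - W * S1b)"
    by (simp add: Wa1[THEN rewrite_prefix] left_diff_distrib distrib_right mult.assoc)
  also have "\<dots> = a1 * S1 * Wb"
  proof -
    have "S1 * S1b + S1 * S1b - W * S1b = S1 * Wb" using W_S1_pair by (simp add: algebra_simps)
    then show ?thesis by (simp add: mult.assoc)
  qed
  finally have 1: "W * (a1 * S1b) = a1 * S1 * Wb" .
  \<comment> \<open>\<open>c1 * a1\<close> anticommutes with both \<open>a1\<close> and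
    \<open>a2\<close>, so it reverses every part of \<open>Y\<close> except
    \<open>W\<close>.\<close>
  have Ye: "Y * (c1 * a1) = c1 * a1 * (W + W - Y)"
  proof -
    have "W * (c1 * a1) = c1 * a1 * W"
      by (simp add: ring Wc1[THEN rewrite_prefix] Wa1 S1a1)
    moreover have "a2 * S2 * (c1 * a1) = - (c1 * a1 * (a2 * S2))"
      by (simp add: mult.assoc S2c1[THEN rewrite_prefix] S2a1 a1a2[THEN rewrite_prefix]
          c1a2[symmetric, THEN rewrite_prefix])
    moreover have "k * a1 * S1 * (c1 * a1) = - (c1 * a1 * (k * a1 * S1))"
      by (simp add: mult.assoc S1c1[THEN rewrite_prefix] S1a1 c1a1[THEN rewrite_prefix] k'[of c1] k'[of a1])
    ultimately show ?thesis
      unfolding Y S by (simp add: distrib_left distrib_right right_diff_distrib)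
  qed
  have "W * Yb + Y * Wb = W * Wb + W * Wb"
  proof -
    have "W * Yb = W * Sb - k * (W * (a1 * S1b))" unfolding Yb by (simp add: ring k'[of W])
    moreover have "Y * Wb = S * Wb + k * (a1 * S1 * Wb)" unfolding Y by (simp add: ring)
    ultimately show ?thesis using W_S_pair by (simp add: 1)
  qed
  then have "W * Yb = (W + W - Y) * Wb" by (simp add: algebra_simps)
  then have "c1 * a1 * (W * Yb) = Y * (c1 * a1) * Wb" by (simp add: Ye mult.assoc)
  then have "g * c * c * (c1 * a1 * (W * Yb)) = g * c * c * (Y * (c1 * a1) * Wb)" by simp
  moreover have "c * Y * d * Wb = - (g * c * c * (Y * (c1 * a1) * Wb))"
    unfolding d_eq by (simp add: mult.assoc g'(1)[of c] g'(1)[of Y] Yc[THEN rewrite_prefix])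
  moreover have "d * W * c * Yb = - (c * d * W * Yb)"
    by (simp add: mult.assoc Wc[THEN rewrite_prefix] dc[THEN rewrite_prefix])
  moreover have "- (c * d * W * Yb) = g * c * c * (c1 * a1 * (W * Yb))"
    unfolding d_eq by (simp add: mult.assoc g'(1)[of c])
  ultimately show ?thesis by simp
qed

text \<open>All cross terms cancel, so only the squares of \<open>a\<close>, \<open>c\<close> and
  \<open>d\<close> remain; \<open>Y_norm\<close> and \<open>W_norm\<close> then express everything
  through products of full transfer matrices.\<close>

lemma t_norm:
  assumes pair: "x * Tb + T * xb = T * Tb + T * Tb"
  shows "t * tb = T * Tb - (a * a + c * c + d * d) * (S * Sb)
    + k * k * (c * c) * (a1 * a1) * (S1 * S1b) - (d * d) * (a2 * a2) * (S2 * S2b)"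
proof -
  have "t * tb = (x * Tb + T * xb - T * Tb) - a * a * (S * Sb) - c * c * (Y * Yb) - d * d * (W * Wb)
     - (T * a * Sb - a * S * Tb)
     - (a * S * (c * Yb + d * Wb) + (c * Y + d * W) * a * Sb)
     - (c * Y * d * Wb + d * W * c * Yb)"
    unfolding t_def tb_def x_def xb_def
    by (simp add: ring Yc[THEN rewrite_prefix] dW[THEN rewrite_prefix] Sa[THEN rewrite_prefix])
  also have "\<dots> = T * Tb - a * a * (S * Sb) - c * c * (Y * Yb) - d * d * (W * Wb)"
    by (simp add: pair T_a_swap hop_cancel cross_cancel)
  finally show ?thesis
    by (simp add: Y_norm W_norm ring k'[of c] algebra_simps)
qed

lemma odd_norm: "(T + a * S) * (Tb - a * Sb) = T * Tb - a * a * (S * Sb)"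
  using T_a_swap by (simp add: ring Sa[THEN rewrite_prefix])

lemma t_T_pair:
  assumes "x * Tb + T * xb = T * Tb + T * Tb"
  shows "t * Tb + T * tb = T * Tb + T * Tb"
  using assms T_a_swap unfolding t_def tb_def by (simp add: ring algebra_simps)

text \<open>Carries the pair identity of \<open>x\<close> up one level. The next even letter
  \<open>C\<close>, with barred letter \<open>D\<close>, is pulled to the front; it reverses the
  signs of \<open>c\<close> and \<open>d\<close> in \<open>t\<close>, and
  \<open>shifted_product\<close> remains.\<close>

lemma next_pair:
  assumes pair: "x * Tb + T * xb = T * Tb + T * Tb" and K: "K = 1 + h * c * c"
    and h: "\<And>z. z * h = h * z" and csq: "\<And>z. z * (c * c) = c * c * z"
    and cC: "c * C = - (C * c)" and aC: "a * C = C * a" and c1C: "c1 * C = C * c1"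
    and a1C: "a1 * C = C * a1" and TC: "T * C = C * T" and SC: "S * C = C * S"
    and S1C: "S1 * C = C * S1" and XC: "X * C = C * X" and WC: "W * C = C * W"
    and D: "D = h * c * a * C"
    and xn: "xn = t + C * (T + K * a * S) + D * X"
    and xnb: "xnb = tb - C * (Tb - K * a * Sb) - D * Xb"
  shows "xn * tb + t * xnb = t * tb + t * tb"
proof -
  have DC: "D = C * (h * a * c)"
  proof -
    have "c * a * C = C * a * c"
      by (simp add: mult.assoc aC cC ca aC[THEN rewrite_prefix] cC[THEN rewrite_prefix])
    then show ?thesis unfolding D by (metis h mult.assoc)
  qed
  have YC: "Y * C = C * Y"
    unfolding Y by (simp add: ring SC S1C k'[of C] a1C[THEN rewrite_prefix])
  have dC: "d * C = - (C * d)"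
    unfolding d by (simp add: mult.assoc cC a1C[THEN rewrite_prefix] c1C[THEN rewrite_prefix] g'(1)[of C])
  have tC: "t * C = C * (T + a * S - c * Y - d * W)"
    unfolding t_def x_def
    by (simp add: ring TC YC WC SC cC[THEN rewrite_prefix] dC[THEN rewrite_prefix] aC[THEN rewrite_prefix])
  have tb: "tb = Tb - a * Sb - c * Yb - d * Wb"
    unfolding tb_def xb_def by simp
  have "xn * tb + t * xnb - t * tb - t * tb
    = C * (T + K * a * S + h * a * c * X) * tb - (t * C) * (Tb - K * a * Sb + h * a * c * Xb)"
    unfolding xn xnb DC by (simp add: ring)
  also have "\<dots> = C * ((T + K * a * S + h * a * c * X) * (Tb - a * Sb - c * Yb - d * Wb)
      - (T + a * S - c * Y - d * W) * (Tb - K * a * Sb + h * a * c * Xb))"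
  proof -
    have "C * p * q - C * r * v = C * (p * q - r * v)" for p q r v
      by (simp add: right_diff_distrib mult.assoc)
    then show ?thesis unfolding tC tb .
  qed
  also have "\<dots> = 0"
    by (simp add: shifted_product[OF pair K h csq])
  finally show ?thesis by (simp add: algebra_simps)
qed

end

section \<open>The chain of letters\<close>

text \<open>Integer indices with zero letters at the nonpositive ones let all relations and
  recursions hold at the start of the chain without case distinctions.\<close>

locale chain_letters =
  fixes h g :: "int \<Rightarrow> 'a::ring_1"
  assumes anti1: "h i * h (i + 1) = - (h (i + 1) * h i)"
    and anti2: "h i * h (i + 2) = - (h (i + 2) * h i)"
    and comm: "i + 2 < j \<Longrightarrow> h i * h j = h j * h i"
    and h_nonpos: "i \<le> 0 \<Longrightarrow> h i = 0"
    and g_central: "z * g m = g m * z"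
    and sq_central: "z * (h i * h i) = h i * h i * z"
begin

lemma anti: "h i * h j = - (h j * h i)" if "\<bar>i - j\<bar> = 1 \<or> \<bar>i - j\<bar> = 2"
proof -
  from that consider "j = i + 1" | "j = i + 2" | "i = j + 1" | "i = j + 2" by linarith
  then show ?thesis
    by cases (simp_all add: anti1[of i] anti2[of i] anti1[of j] anti2[of j])
qed

lemma comm': "h i * h j = h j * h i" if "\<bar>i - j\<bar> > 2"
  using comm[of i j] comm[of j i] that by (cases "i < j") auto

end

section \<open>Sequences that obey the transfer matrix recursion\<close>

locale operator_chain = chain_letters h g
  for h g :: "int \<Rightarrow> 'a::ring_1" +
  fixes t tb :: "int \<Rightarrow> 'a"
  assumes t_init: "m \<le> 0 \<Longrightarrow> t m = 1"
    and tb_init: "m \<le> 0 \<Longrightarrow> tb m = 1"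
    and t_rec: "t m = t (m - 1) + h (2 * m - 1) * t (m - 2)
      + h (2 * m) * (t (m - 2) + h (2 * m - 3) * t (m - 3))
      + g m * h (2 * m - 2) * h (2 * m - 3) * h (2 * m)
        * (t (m - 2) - h (2 * m - 5) * t (m - 4) + h (2 * m - 2) * t (m - 3))"
    and tb_rec: "tb m = tb (m - 1) - h (2 * m - 1) * tb (m - 2)
      - h (2 * m) * (tb (m - 2) - h (2 * m - 3) * tb (m - 3))
      - g m * h (2 * m - 2) * h (2 * m - 3) * h (2 * m)
        * (tb (m - 2) + h (2 * m - 5) * tb (m - 4) - h (2 * m - 2) * tb (m - 3))"
begin

definition "d m = g m * h (2 * m - 2) * h (2 * m - 3) * h (2 * m)"
definition "k m = 1 + g m * h (2 * m - 2) * h (2 * m - 2)"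
definition "x m = t m - h (2 * m - 1) * t (m - 2)"
definition "xb m = tb m + h (2 * m - 1) * tb (m - 2)"
definition "y m = t (m - 2) + k m * h (2 * m - 3) * t (m - 3)"
definition "yb m = tb (m - 2) - k m * h (2 * m - 3) * tb (m - 3)"

text \<open>\<open>h (2 * m - 2)\<close> meets its copy in \<open>d m\<close> and leaves a central
  square, so this term merges with that of \<open>h (2 * m)\<close> and yields \<open>k m\<close> in
  \<open>y m\<close>.\<close>

lemma d_h: "d m * h (2 * m - 2) = h (2 * m) * (g m * h (2 * m - 2) * h (2 * m - 2) * h (2 * m - 3))"
proof -
  have "h (2 * m - 3) * h (2 * m) = h (2 * m) * h (2 * m - 3)"
    by (rule comm') simp
  moreover have "h (2 * m - 3) * h (2 * m - 2) = - (h (2 * m - 2) * h (2 * m - 3))"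
    "h (2 * m) * h (2 * m - 2) = - (h (2 * m - 2) * h (2 * m))"
    by (rule anti; simp)+
  moreover have "h (2 * m) * (g m * z) = g m * (h (2 * m) * z)" for z
    using g_central by (metis mult.assoc)
  ultimately show ?thesis
    unfolding d_def by (simp add: mult.assoc rewrite_prefix[of "h (2 * m)" "h (2 * m - 2)"]
        rewrite_prefix[of "h (2 * m - 3)" "h (2 * m - 2)"])
qed

lemma x_rec: "x m = t (m - 1) + h (2 * m) * y m + d m * x (m - 2)"
proof -
  have "d m * (h (2 * m - 2) * z) = h (2 * m) * (g m * h (2 * m - 2) * h (2 * m - 2) * h (2 * m - 3)) * z" for z
    by (metis d_h mult.assoc)
  then show ?thesis
    unfolding x_def y_def k_def using t_rec[of m, folded d_def]
    by (simp add: distrib_left distrib_right right_diff_distrib mult.assoc)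
qed

lemma xb_rec: "xb m = tb (m - 1) - h (2 * m) * yb m - d m * xb (m - 2)"
proof -
  have "d m * (h (2 * m - 2) * z) = h (2 * m) * (g m * h (2 * m - 2) * h (2 * m - 2) * h (2 * m - 3)) * z" for z
    by (metis d_h mult.assoc)
  then show ?thesis
    unfolding xb_def yb_def k_def using tb_rec[of m, folded d_def]
    by (simp add: distrib_left distrib_right right_diff_distrib mult.assoc)
qed

text \<open>\<open>t m\<close> is built from letters of index at most \<open>2 * m\<close>, all at
  distance more than 2 from \<open>i\<close>.\<close>

lemma t_h: "2 * m + 3 \<le> i \<Longrightarrow> t m * h i = h i * t m"
proof (induction "nat m" arbitrary: m rule: less_induct)
  case less
  show ?case
  proof (cases "m \<le> 0")
    case True
    then show ?thesis by (simp add: t_init)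
  next
    case False
    have T: "t n * h i = h i * t n" if "n < m" for n
      using less that False by (intro less.hyps) auto
    have H: "h l * h i = h i * h l" if "l \<le> 2 * m" for l
      using less.prems that by (intro comm') auto
    have G: "h i * (g m * z) = g m * (h i * z)" for z
      using g_central by (metis mult.assoc)
    show ?thesis
      by (subst (1 2) t_rec) (simp add: distrib_left distrib_right left_diff_distrib right_diff_distrib
        mult.assoc T H G H[THEN rewrite_prefix])
  qed
qed

lemma x_h: "x m * h i = h i * x m" if "2 * m + 3 \<le> i"
proof -
  have "h (2 * m - 1) * h i = h i * h (2 * m - 1)"
    using that by (intro comm') simp
  then have "h (2 * m - 1) * (h i * z) = h i * (h (2 * m - 1) * z)" for z
    by (metis mult.assoc)
  then show ?thesis
    using that unfolding x_def
    by (simp add: left_diff_distrib right_diff_distrib t_h mult.assoc)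
qed

lemma k_central: "z * k m = k m * z"
  using sq_central[of z "2 * m - 2"] g_central[of z m] unfolding k_def
  by (simp add: distrib_left distrib_right mult.assoc) (metis g_central mult.assoc)

lemma y_h: "y m * h i = h i * y m" if "2 * m \<le> i"
proof -
  have "h (2 * m - 3) * h i = h i * h (2 * m - 3)"
    using that by (intro comm') simp
  then have "h (2 * m - 3) * (h i * z) = h i * (h (2 * m - 3) * z)" for z
    by (metis mult.assoc)
  moreover have "h i * (k m * z) = k m * (h i * z)" for z
    by (metis k_central mult.assoc)
  ultimately show ?thesis
    using that unfolding y_def by (simp add: distrib_left distrib_right mult.assoc t_h)
qed

text \<open>The next two letters anticommute with \<open>h (2 * m)\<close>, hence with
  \<open>d m\<close>, and commute with all else in \<open>x_rec\<close>; so they reflect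
  \<open>x m\<close> in \<open>t (m - 1)\<close>.\<close>

lemma x_next_h: "x m * h i = h i * (t (m - 1) + t (m - 1) - x m)"
  if "i = 2 * m + 1 \<or> i = 2 * m + 2"
proof -
  have H: "h (2 * m) * h i = - (h i * h (2 * m))"
    using that by (intro anti) auto
  have C: "h (2 * m - 2) * h i = h i * h (2 * m - 2)" "h (2 * m - 3) * h i = h i * h (2 * m - 3)"
    using that by (intro comm'; auto)+
  have "h i * (g m * z) = g m * (h i * z)" for z
    by (metis g_central mult.assoc)
  then have "d m * h i = - (h i * d m)"
    unfolding d_def by (simp add: mult.assoc H C[THEN rewrite_prefix])
  note flip = this[THEN rewrite_prefix] H[THEN rewrite_prefix]
  have "t (m - 1) * h i = h i * t (m - 1)" "y m * h i = h i * y m"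
    "x (m - 2) * h i = h i * x (m - 2)"
    using that by (intro t_h y_h x_h; auto)+
  then show ?thesis
    unfolding x_rec[of m] by (simp add: distrib_left distrib_right right_diff_distrib mult.assoc flip)
qed

text \<open>The invariant of the simultaneous induction: at levels \<open>m - 1\<close> and
  \<open>m - 2\<close> it supplies the bilinear hypotheses of \<open>transfer_step\<close>.\<close>

definition "bilinear m \<longleftrightarrow>
    x m * h (2 * m - 1) * tb (m - 2) = h (2 * m - 1) * t (m - 2) * xb m
  \<and> x m * tb (m - 1) + t (m - 1) * xb m = t (m - 1) * tb (m - 1) + t (m - 1) * tb (m - 1)
  \<and> t m * tb (m - 1) + t (m - 1) * tb m = t (m - 1) * tb (m - 1) + t (m - 1) * tb (m - 1)
  \<and> h (2 * m) * h (2 * m - 1) * x (m - 1) * xb m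
      + (x m - t (m - 1) - t (m - 1)) * h (2 * m) * h (2 * m - 1) * xb (m - 1)
    = h (2 * m) * h (2 * m)
      * (t (m - 1) * h (2 * m - 1) * tb (m - 2) + t (m - 1) * h (2 * m - 1) * tb (m - 2))"

lemma step:
  assumes "bilinear (m - 1)" "bilinear (m - 2)"
  shows "transfer_step (h (2 * m - 1)) (h (2 * m)) (h (2 * m - 3)) (h (2 * m - 5)) (h (2 * m - 2)) (g m)
    (t (m - 1)) (t (m - 2)) (t (m - 3)) (t (m - 4)) (x (m - 1)) (x (m - 2))
    (tb (m - 1)) (tb (m - 2)) (tb (m - 3)) (tb (m - 4)) (xb (m - 1)) (xb (m - 2))
    (d m) (k m) (y m) (yb m)"
proof unfold_locales
  let ?a = "h (2 * m - 1)" and ?c = "h (2 * m)" and ?a1 = "h (2 * m - 3)"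
    and ?a2 = "h (2 * m - 5)" and ?c1 = "h (2 * m - 2)"
  show "?c * ?a = - (?a * ?c)" "?c * ?c1 = - (?c1 * ?c)" "?c1 * ?a1 = - (?a1 * ?c1)"
    "?c1 * ?a = - (?a * ?c1)" "?a1 * ?a = - (?a * ?a1)" "?a1 * ?a2 = - (?a2 * ?a1)"
    by (rule anti; simp)+
  show "?c * ?a1 = ?a1 * ?c" "?c * ?a2 = ?a2 * ?c" "?c1 * ?a2 = ?a2 * ?c1"
    by (rule comm'; simp)+
  show "t (m - 2) * ?a = ?a * t (m - 2)" "t (m - 2) * ?c = ?c * t (m - 2)"
    "t (m - 3) * ?c = ?c * t (m - 3)" "t (m - 3) * ?a = ?a * t (m - 3)"
    "t (m - 3) * ?a1 = ?a1 * t (m - 3)" "t (m - 3) * ?c1 = ?c1 * t (m - 3)"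
    "t (m - 4) * ?a1 = ?a1 * t (m - 4)" "t (m - 4) * ?c1 = ?c1 * t (m - 4)"
    "t (m - 4) * ?c = ?c * t (m - 4)" "t (m - 4) * ?a2 = ?a2 * t (m - 4)"
    by (rule t_h; simp)+
  show "x (m - 2) * ?a = ?a * x (m - 2)" "x (m - 2) * ?c = ?c * x (m - 2)"
    by (rule x_h; simp)+
  show "x (m - 1) * ?a = ?a * (t (m - 2) + t (m - 2) - x (m - 1))"
    "x (m - 1) * ?c = ?c * (t (m - 2) + t (m - 2) - x (m - 1))"
    "x (m - 2) * ?a1 = ?a1 * (t (m - 3) + t (m - 3) - x (m - 2))"
    "x (m - 2) * ?c1 = ?c1 * (t (m - 3) + t (m - 3) - x (m - 2))"
    using x_next_h[of _ "m - 1"] x_next_h[of _ "m - 2"] by simp_all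
  show "z * g m = g m * z" "z * (?c1 * ?c1) = ?c1 * ?c1 * z" for z
    by (rule g_central sq_central)+
  show "t (m - 1) = x (m - 1) + ?a1 * t (m - 3)" "tb (m - 1) = xb (m - 1) - ?a1 * tb (m - 3)"
    "t (m - 2) = x (m - 2) + ?a2 * t (m - 4)" "tb (m - 2) = xb (m - 2) - ?a2 * tb (m - 4)"
    unfolding x_def xb_def by (simp_all add: right_diff_distrib)
  show "d m = g m * ?c1 * ?a1 * ?c" "k m = 1 + g m * ?c1 * ?c1"
    "y m = t (m - 2) + k m * ?a1 * t (m - 3)" "yb m = tb (m - 2) - k m * ?a1 * tb (m - 3)"
    by (simp_all add: d_def k_def y_def yb_def)
  show "x (m - 1) * ?a1 * tb (m - 3) = ?a1 * t (m - 3) * xb (m - 1)"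
    "x (m - 2) * ?a2 * tb (m - 4) = ?a2 * t (m - 4) * xb (m - 2)"
    "x (m - 1) * tb (m - 2) + t (m - 2) * xb (m - 1) = t (m - 2) * tb (m - 2) + t (m - 2) * tb (m - 2)"
    "t (m - 1) * tb (m - 2) + t (m - 2) * tb (m - 1) = t (m - 2) * tb (m - 2) + t (m - 2) * tb (m - 2)"
    "t (m - 2) * tb (m - 3) + t (m - 3) * tb (m - 2) = t (m - 3) * tb (m - 3) + t (m - 3) * tb (m - 3)"
    "x (m - 2) * tb (m - 3) + t (m - 3) * xb (m - 2) = t (m - 3) * tb (m - 3) + t (m - 3) * tb (m - 3)"
    "?c1 * ?a1 * x (m - 2) * xb (m - 1) + (x (m - 1) - t (m - 2) - t (m - 2)) * ?c1 * ?a1 * xb (m - 2)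
      = ?c1 * ?c1 * (t (m - 2) * ?a1 * tb (m - 3) + t (m - 2) * ?a1 * tb (m - 3))"
    using assms unfolding bilinear_def by (simp_all add: right_diff_distrib)
qed

lemma bilinear: "bilinear m"
proof (induction "nat m" arbitrary: m rule: less_induct)
  case less
  show ?case
  proof (cases "m \<le> 0")
    case True
    then show ?thesis unfolding bilinear_def x_def xb_def
      by (simp add: t_init tb_init h_nonpos)
  next
    case False
    then have IH: "bilinear n" if "n < m" for n
      using that by (intro less.hyps) auto
    interpret cur: transfer_step "h (2 * m - 1)" "h (2 * m)" "h (2 * m - 3)" "h (2 * m - 5)"
      "h (2 * m - 2)" "g m" "t (m - 1)" "t (m - 2)" "t (m - 3)" "t (m - 4)" "x (m - 1)" "x (m - 2)"
      "tb (m - 1)" "tb (m - 2)" "tb (m - 3)" "tb (m - 4)" "xb (m - 1)" "xb (m - 2)"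
      "d m" "k m" "y m" "yb m"
      by (intro step IH) auto
    \<comment> \<open>Three of the four identities come from the step at level \<open>m\<close>; the
      pair identity of \<open>x m\<close> needs the step at level \<open>m - 1\<close>, through
      \<open>next_pair\<close>.\<close>
    interpret prev: transfer_step "h (2 * (m - 1) - 1)" "h (2 * (m - 1))" "h (2 * (m - 1) - 3)"
      "h (2 * (m - 1) - 5)" "h (2 * (m - 1) - 2)" "g (m - 1)" "t (m - 1 - 1)" "t (m - 1 - 2)"
      "t (m - 1 - 3)" "t (m - 1 - 4)" "x (m - 1 - 1)" "x (m - 1 - 2)" "tb (m - 1 - 1)"
      "tb (m - 1 - 2)" "tb (m - 1 - 3)" "tb (m - 1 - 4)" "xb (m - 1 - 1)" "xb (m - 1 - 2)"
      "d (m - 1)" "k (m - 1)" "y (m - 1)" "yb (m - 1)"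
      by (intro step IH) auto
    have x: "cur.x = x m" "cur.xb = xb m"
      unfolding cur.x_def cur.xb_def x_rec[of m] xb_rec[of m] by simp_all
    have t: "cur.t = t m" "cur.tb = tb m"
      unfolding cur.t_def cur.tb_def x by (simp_all add: x_def xb_def)
    have px: "prev.x = x (m - 1)" "prev.xb = xb (m - 1)"
      unfolding prev.x_def prev.xb_def x_rec[of "m - 1"] xb_rec[of "m - 1"] by simp_all
    have pt: "prev.t = t (m - 1)" "prev.tb = tb (m - 1)"
      unfolding prev.t_def prev.tb_def px by (simp_all add: x_def xb_def right_diff_distrib)
    have X: "x m * tb (m - 1) + t (m - 1) * xb m = t (m - 1) * tb (m - 1) + t (m - 1) * tb (m - 1)"
    proof (rule prev.next_pair[of "k m" "g m" "h (2 * m)" "d m" "x m" "xb m", unfolded px pt])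
      show "x (m - 1) * tb (m - 1 - 1) + t (m - 1 - 1) * xb (m - 1)
          = t (m - 1 - 1) * tb (m - 1 - 1) + t (m - 1 - 1) * tb (m - 1 - 1)"
        using IH[of "m - 1"] unfolding bilinear_def by simp
      show "h (2 * (m - 1)) * h (2 * m) = - (h (2 * m) * h (2 * (m - 1)))"
        by (rule anti) simp
      show "h (2 * (m - 1) - 1) * h (2 * m) = h (2 * m) * h (2 * (m - 1) - 1)"
        "h (2 * (m - 1) - 2) * h (2 * m) = h (2 * m) * h (2 * (m - 1) - 2)"
        "h (2 * (m - 1) - 3) * h (2 * m) = h (2 * m) * h (2 * (m - 1) - 3)"
        by (rule comm'; simp)+
      show "t (m - 1 - 1) * h (2 * m) = h (2 * m) * t (m - 1 - 1)"
        "t (m - 1 - 2) * h (2 * m) = h (2 * m) * t (m - 1 - 2)"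
        "t (m - 1 - 3) * h (2 * m) = h (2 * m) * t (m - 1 - 3)"
        by (rule t_h; simp)+
      show "x (m - 1 - 1) * h (2 * m) = h (2 * m) * x (m - 1 - 1)"
        "x (m - 1 - 2) * h (2 * m) = h (2 * m) * x (m - 1 - 2)"
        by (rule x_h; simp)+
      show "z * g m = g m * z" "z * (h (2 * (m - 1)) * h (2 * (m - 1))) = h (2 * (m - 1)) * h (2 * (m - 1)) * z" for z
        by (rule g_central sq_central)+
      show "k m = 1 + g m * h (2 * (m - 1)) * h (2 * (m - 1))"
        "d m = g m * h (2 * (m - 1)) * h (2 * (m - 1) - 1) * h (2 * m)"
        by (simp_all add: k_def d_def right_diff_distrib)
      show "x m = t (m - 1) + h (2 * m) * (t (m - 1 - 1) + k m * h (2 * (m - 1) - 1) * t (m - 1 - 2)) + d m * x (m - 1 - 1)"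
        "xb m = tb (m - 1) - h (2 * m) * (tb (m - 1 - 1) - k m * h (2 * (m - 1) - 1) * tb (m - 1 - 2)) - d m * xb (m - 1 - 1)"
        unfolding x_rec[of m] xb_rec[of m] y_def yb_def by (simp_all add: right_diff_distrib)
    qed
    show ?thesis
      unfolding bilinear_def
      using cur.x_a_swap cur.x_c_a_exchange X cur.t_T_pair unfolding x t by blast
  qed
qed

lemma t_tb:
  "t m * tb m = t (m - 1) * tb (m - 1)
    - (h (2 * m - 1) * h (2 * m - 1) + h (2 * m) * h (2 * m) + d m * d m) * (t (m - 2) * tb (m - 2))
    + k m * k m * (h (2 * m) * h (2 * m)) * (h (2 * m - 3) * h (2 * m - 3)) * (t (m - 3) * tb (m - 3))
    - (d m * d m) * (h (2 * m - 5) * h (2 * m - 5)) * (t (m - 4) * tb (m - 4))"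
proof -
  interpret cur: transfer_step "h (2 * m - 1)" "h (2 * m)" "h (2 * m - 3)" "h (2 * m - 5)"
      "h (2 * m - 2)" "g m" "t (m - 1)" "t (m - 2)" "t (m - 3)" "t (m - 4)" "x (m - 1)" "x (m - 2)"
      "tb (m - 1)" "tb (m - 2)" "tb (m - 3)" "tb (m - 4)" "xb (m - 1)" "xb (m - 2)"
      "d m" "k m" "y m" "yb m"
    by (intro step bilinear)
  have x: "cur.x = x m" "cur.xb = xb m"
    unfolding cur.x_def cur.xb_def x_rec[of m] xb_rec[of m] by simp_all
  have t: "cur.t = t m" "cur.tb = tb m"
    unfolding cur.t_def cur.tb_def x by (simp_all add: x_def xb_def)
  show ?thesis
    by (rule cur.t_norm[unfolded t x]) (use bilinear[of m] in \<open>simp add: bilinear_def\<close>)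
qed

lemma t_tb_odd:
  "(t (m - 1) + h (2 * m - 1) * t (m - 2)) * (tb (m - 1) - h (2 * m - 1) * tb (m - 2))
    = t (m - 1) * tb (m - 1) - h (2 * m - 1) * h (2 * m - 1) * (t (m - 2) * tb (m - 2))"
proof -
  interpret cur: transfer_step "h (2 * m - 1)" "h (2 * m)" "h (2 * m - 3)" "h (2 * m - 5)"
      "h (2 * m - 2)" "g m" "t (m - 1)" "t (m - 2)" "t (m - 3)" "t (m - 4)" "x (m - 1)" "x (m - 2)"
      "tb (m - 1)" "tb (m - 2)" "tb (m - 3)" "tb (m - 4)" "xb (m - 1)" "xb (m - 2)"
      "d m" "k m" "y m" "yb m"
    by (intro step bilinear)
  show ?thesis by (rule cur.odd_norm)
qed

end

section \<open>Sums over independent sets\<close>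

text \<open>A noncommutative independence polynomial, with the variable absorbed into the weights
  \<open>f\<close>.\<close>

definition indep_sum :: "(int \<times> bool \<Rightarrow> 'a::ring_1) \<Rightarrow> (int \<times> bool) set \<Rightarrow> 'a" where
  "indep_sum f V = (\<Sum>S | S \<subseteq> V \<and> independent S. prod_list (map f (sorted_list_of_set S)))"

lemma indep_sum_cong: "indep_sum f V = indep_sum f' V"
  if "\<And>v. v \<in> V \<Longrightarrow> f v = f' v" "finite V"
  unfolding indep_sum_def
proof (rule sum.cong)
  fix S assume "S \<in> {S. S \<subseteq> V \<and> independent S}"
  then have "S \<subseteq> V" "finite S" using that(2) finite_subset by auto
  then have "map f (sorted_list_of_set S) = map f' (sorted_list_of_set S)"
    using that(1) by (auto simp: map_eq_conv)
  then show "prod_list (map f (sorted_list_of_set S)) = prod_list (map f' (sorted_list_of_set S))"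
    by (rule arg_cong)
qed simp

lemma indep_sum_empty [simp]: "indep_sum f {} = 1"
proof -
  have "{S. S \<subseteq> {} \<and> independent S} = {{}}" by (auto simp: independent_def)
  then show ?thesis unfolding indep_sum_def by simp
qed

lemma prod_list_insort:
  fixes f :: "'b::linorder \<Rightarrow> 'a::monoid_mult"
  assumes "\<And>y. y \<in> set ys \<Longrightarrow> f v * f y = f y * f v"
  shows "prod_list (map f (insort v ys)) = f v * prod_list (map f ys)"
  using assms
proof (induction ys)
  case (Cons y ys)
  then have "f y * (f v * z) = f v * (f y * z)" for z by (metis list.set_intros(1) mult.assoc)
  with Cons show ?case by (simp add: mult.assoc)
qed simp

lemma adjacent_sym: "adjacent v w \<longleftrightarrow> adjacent w v"
  unfolding adjacent_def by (cases v; cases w) (auto split: bool.splits)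

lemma not_adjacent_self: "\<not> adjacent v v"
  unfolding adjacent_def by (cases v) (auto split: bool.splits)

text \<open>An independent set either avoids \<open>v\<close> or is \<open>v\<close> together with
  an independent set of non-neighbours. Commutation moves \<open>f v\<close> from its sorted
  position to the front.\<close>

lemma indep_sum_insert:
  assumes V: "finite V" "v \<notin> V" and N: "{w \<in> V. \<not> adjacent v w} = N"
    and comm: "\<And>w. w \<in> N \<Longrightarrow> f v * f w = f w * f v"
  shows "indep_sum f (insert v V) = indep_sum f V + f v * indep_sum f N"
proof -
  let ?I = "\<lambda>V. {S. S \<subseteq> V \<and> independent S}"
  let ?p = "\<lambda>S. prod_list (map f (sorted_list_of_set S))"
  have fin: "finite N" "N \<subseteq> V" "v \<notin> N" using V N by auto
  have split: "?I (insert v V) = ?I V \<union> insert v ` ?I N"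
  proof (intro equalityI subsetI)
    fix S assume S: "S \<in> ?I (insert v V)"
    show "S \<in> ?I V \<union> insert v ` ?I N"
    proof (cases "v \<in> S")
      case True
      then have "S = insert v (S - {v})" "S - {v} \<in> ?I N"
        using S N by (auto simp: independent_def)
      then show ?thesis by blast
    qed (use S in auto)
  next
    fix S assume "S \<in> ?I V \<union> insert v ` ?I N"
    moreover have "w \<in> V \<and> \<not> adjacent v w \<and> \<not> adjacent w v" if "w \<in> N" for w
      using that N adjacent_sym by blast
    ultimately show "S \<in> ?I (insert v V)"
      unfolding independent_def using not_adjacent_self by (auto dest: subsetD)
  qed
  have inj: "inj_on (insert v) (?I N)"
    using fin(3) by (auto simp: inj_on_def dest: insert_ident[THEN iffD1, rotated 2])
  have "indep_sum f (insert v V) = indep_sum f V + sum ?p (insert v ` ?I N)"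
    unfolding indep_sum_def split using V fin by (intro sum.union_disjoint) auto
  also have "sum ?p (insert v ` ?I N) = (\<Sum>S\<in>?I N. f v * ?p S)"
    unfolding sum.reindex[OF inj] o_def
  proof (rule sum.cong)
    fix S assume "S \<in> ?I N"
    then have S: "finite S" "v \<notin> S" "S \<subseteq> N" using fin finite_subset by auto
    then have "?p (insert v S) = prod_list (map f (insort v (sorted_list_of_set S)))"
      by (simp add: sorted_list_of_set_insert)
    also have "\<dots> = f v * ?p S"
      using S comm by (intro prod_list_insort) auto
    finally show "?p (insert v S) = f v * ?p S" .
  qed simp
  finally show ?thesis unfolding indep_sum_def by (simp add: sum_distrib_left)
qed

section \<open>Frustration graphs of integer size and their vertex deletions\<close>

definition graph :: "int \<Rightarrow> (int \<times> bool) set" where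
  "graph j = {(l, False) | l. 1 \<le> l \<and> l \<le> j} \<union> {(2 * m + 1, True) | m. 2 \<le> m \<and> m \<le> j div 2}"

lemma graph_simps [simp]:
  "(l, False) \<in> graph j \<longleftrightarrow> 1 \<le> l \<and> l \<le> j"
  "(l, True) \<in> graph j \<longleftrightarrow> odd l \<and> 5 \<le> l \<and> l \<le> j + 1"
  unfolding graph_def by (auto elim!: oddE)

lemma adjacent_simps [simp]:
  "adjacent (i, False) (l, False) \<longleftrightarrow> \<bar>i - l\<bar> = 1 \<or> \<bar>i - l\<bar> = 2"
  "adjacent (n, True) (l, False) \<longleftrightarrow> l \<in> {n - 6, n - 4, n - 2, n, n - 1, n + 1}"
  "adjacent (l, False) (n, True) \<longleftrightarrow> l \<in> {n - 6, n - 4, n - 2, n, n - 1, n + 1}"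
  "adjacent (n, True) (n', True) \<longleftrightarrow> \<bar>n - n'\<bar> = 2"
  unfolding adjacent_def by auto

lemma finite_graph [simp]: "finite (graph j)"
proof -
  have "graph j \<subseteq> {1..j + 1} \<times> UNIV"
    by (auto simp: graph_def)
  then show ?thesis by (rule finite_subset) simp
qed

lemma set_eq_vertexI:
  assumes "\<And>l. (l, False) \<in> A \<longleftrightarrow> (l, False) \<in> B" "\<And>l. (l, True) \<in> A \<longleftrightarrow> (l, True) \<in> B"
  shows "A = B"
proof (rule set_eqI)
  fix v show "v \<in> A \<longleftrightarrow> v \<in> B"
    using assms by (cases v; cases "snd v") auto
qed

lemma graph_nonpos: "j \<le> 0 \<Longrightarrow> graph j = {}"
  by (rule set_eq_vertexI) auto

lemma graph_odd: "1 \<le> m \<Longrightarrow> graph (2 * m - 1) = insert (2 * m - 1, False) (graph (2 * m - 2))"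
  by (rule set_eq_vertexI) (auto; presburger)+

lemma graph_even: "2 \<le> m \<Longrightarrow> graph (2 * m) = insert (2 * m + 1, True) (insert (2 * m, False) (graph (2 * m - 1)))"
  by (rule set_eq_vertexI) (auto; presburger)+

lemma graph_two: "graph 2 = insert (2, False) (graph 1)"
  by (rule set_eq_vertexI) (auto; presburger)+

lemma nonneighbours_odd: "{w \<in> graph (2 * m - 2). \<not> adjacent (2 * m - 1, False) w} = graph (2 * m - 4)"
  by (rule set_eq_vertexI) (auto; presburger)+

lemma nonneighbours_even: "{w \<in> graph (2 * m - 1). \<not> adjacent (2 * m, False) w} = graph (2 * m - 3)"
  by (rule set_eq_vertexI) (auto; presburger)+

text \<open>This is not a graph of smaller size: one vertex is extra and one is missing. The next
  two lemmas serve to remove both defects.\<close>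

lemma nonneighbours_bar:
  assumes "2 \<le> m"
  shows "{w \<in> insert (2 * m, False) (graph (2 * m - 1)). \<not> adjacent (2 * m + 1, True) w}
    = insert (2 * m - 2, False) (graph (2 * m - 4) - {(2 * m - 5, False)})"
  by (rule set_eq_vertexI) (use assms in \<open>auto; presburger\<close>)+

lemma nonneighbours_inner:
  "{w \<in> graph (2 * m - 4) - {(2 * m - 5, False)}. \<not> adjacent (2 * m - 2, False) w} = graph (2 * m - 6)"
  by (rule set_eq_vertexI) (auto; presburger)+

lemma nonneighbours_removed:
  "{w \<in> graph (2 * m - 4) - {(2 * m - 5, False)}. \<not> adjacent (2 * m - 5, False) w} = graph (2 * m - 8)"
  by (rule set_eq_vertexI) (auto; presburger)+

section \<open>The recursion for the transfer matrices\<close>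

context chain_letters
begin

definition vertex_letter :: "int \<times> bool \<Rightarrow> 'a" where
  "vertex_letter v = (case v of (l, False) \<Rightarrow> h l
    | (n, True) \<Rightarrow> g (n div 2) * h (n - 3) * h (n - 4) * h (n - 1))"

definition "transfer j = indep_sum vertex_letter (graph j)"

lemma vertex_letter_simps [simp]:
  "vertex_letter (l, False) = h l"
  "vertex_letter (n, True) = g (n div 2) * h (n - 3) * h (n - 4) * h (n - 1)"
  by (simp_all add: vertex_letter_def)

lemma g_left: "z * (g m * w) = g m * (z * w)"
  using g_central by (metis mult.assoc)

lemma bar_commute:
  assumes "z * h (n - 3) = h (n - 3) * z" "z * h (n - 4) = h (n - 4) * z" "z * h (n - 1) = h (n - 1) * z"
  shows "z * vertex_letter (n, True) = vertex_letter (n, True) * z"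
  using assms by (simp add: mult.assoc g_left assms[THEN rewrite_prefix])

lemma letter_commute:
  assumes "w \<in> graph j" and "\<And>i. i \<le> j \<Longrightarrow> z * h i = h i * z"
  shows "z * vertex_letter w = vertex_letter w * z"
proof (cases w)
  case (Pair l s)
  show ?thesis
  proof (cases s)
    case True
    with assms Pair show ?thesis
      by (simp only:) (intro bar_commute; auto)
  next
    case False
    with assms Pair show ?thesis by auto
  qed
qed

lemma transfer_nonpos: "j \<le> 0 \<Longrightarrow> transfer j = 1"
  by (simp add: transfer_def graph_nonpos)

lemma transfer_odd: "transfer (2 * m - 1) = transfer (2 * m - 2) + h (2 * m - 1) * transfer (2 * m - 4)"
proof (cases "1 \<le> m")
  case True
  have "h (2 * m - 1) * vertex_letter w = vertex_letter w * h (2 * m - 1)"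
    if "w \<in> graph (2 * m - 4)" for w
    using that by (rule letter_commute) (auto intro: comm')
  then show ?thesis
    unfolding transfer_def graph_odd[OF True]
    by (subst indep_sum_insert[OF _ _ nonneighbours_odd]) auto
next
  case False
  then show ?thesis by (simp add: transfer_nonpos h_nonpos)
qed

lemma insert_even:
  "indep_sum vertex_letter (insert (2 * m, False) (graph (2 * m - 1)))
    = transfer (2 * m - 1) + h (2 * m) * transfer (2 * m - 3)"
proof -
  have "h (2 * m) * vertex_letter w = vertex_letter w * h (2 * m)"
    if "w \<in> graph (2 * m - 3)" for w
    using that by (rule letter_commute) (auto intro: comm')
  then show ?thesis
    unfolding transfer_def
    by (subst indep_sum_insert[OF _ _ nonneighbours_even]) auto
qed

text \<open>The deletion recursion at \<open>2 * m - 5\<close> is solved for the graph lacking that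
  vertex, whence the minus sign.\<close>

lemma inner_sum:
  assumes "2 \<le> m"
  shows "indep_sum vertex_letter (insert (2 * m - 2, False) (graph (2 * m - 4) - {(2 * m - 5, False)}))
    = transfer (2 * m - 4) - h (2 * m - 5) * transfer (2 * m - 8) + h (2 * m - 2) * transfer (2 * m - 6)"
proof -
  let ?G = "graph (2 * m - 4) - {(2 * m - 5, False)}"
  have "h (2 * m - 2) * vertex_letter w = vertex_letter w * h (2 * m - 2)"
    if "w \<in> graph (2 * m - 6)" for w
    using that by (rule letter_commute) (auto intro: comm')
  then have "indep_sum vertex_letter (insert (2 * m - 2, False) ?G)
      = indep_sum vertex_letter ?G + h (2 * m - 2) * transfer (2 * m - 6)"
    unfolding transfer_def
    by (subst indep_sum_insert[OF _ _ nonneighbours_inner]) auto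
  moreover have "transfer (2 * m - 4) = indep_sum vertex_letter ?G + h (2 * m - 5) * transfer (2 * m - 8)"
  proof (cases "3 \<le> m")
    case True
    then have G: "graph (2 * m - 4) = insert (2 * m - 5, False) ?G" by auto
    have "h (2 * m - 5) * vertex_letter w = vertex_letter w * h (2 * m - 5)"
      if "w \<in> graph (2 * m - 8)" for w
      using that by (rule letter_commute) (auto intro: comm')
    then show ?thesis
      unfolding transfer_def
      by (subst G, subst indep_sum_insert[OF _ _ nonneighbours_removed]) auto
  next
    \<comment> \<open>For \<open>m = 2\<close> the index \<open>2 * m - 5\<close> is negative:
      nothing was removed, and the letter is zero.\<close>
    case False
    then have "?G = graph (2 * m - 4)" using assms by auto
    with False show ?thesis unfolding transfer_def by (simp add: h_nonpos)
  qed
  ultimately show ?thesis by (simp add: algebra_simps)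
qed

text \<open>Each \<open>h i\<close> in question anticommutes with none or exactly two of the three
  factors of the barred letter, up to equal factors. The barred letters in the set are products of
  such \<open>h i\<close>.\<close>

lemma bar_letter_commute:
  assumes "w \<in> insert (2 * m - 2, False) (graph (2 * m - 4) - {(2 * m - 5, False)})"
  shows "vertex_letter (2 * m + 1, True) * vertex_letter w = vertex_letter w * vertex_letter (2 * m + 1, True)"
proof -
  have H: "h i * vertex_letter (2 * m + 1, True) = vertex_letter (2 * m + 1, True) * h i"
    if "i \<le> 2 * m - 6 \<or> i = 2 * m - 4 \<or> i = 2 * m - 2" for i
  proof (cases "i \<le> 2 * m - 6")
    case True
    then show ?thesis by (intro bar_commute comm') auto
  next
    case False
    with that consider "i = 2 * m - 4" | "i = 2 * m - 2" by blast
    then show ?thesis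
    proof cases
      case 1
      then have "h i * h (2 * m - 2) = - (h (2 * m - 2) * h i)" "h i * h (2 * m - 3) = - (h (2 * m - 3) * h i)"
        "h i * h (2 * m) = h (2 * m) * h i"
        by (intro anti comm'; simp)+
      from this this(1,2)[THEN rewrite_prefix] show ?thesis by (simp add: mult.assoc g_left)
    next
      case 2
      then have "h i * h (2 * m - 3) = - (h (2 * m - 3) * h i)" "h i * h (2 * m) = - (h (2 * m) * h i)"
        by (intro anti; simp)+
      from this this(1)[THEN rewrite_prefix] show ?thesis
        by (simp add: mult.assoc g_left) (simp add: 2)
    qed
  qed
  show ?thesis
  proof (cases w)
    case (Pair l s)
    then consider "w = (l, False)" "l \<le> 2 * m - 6 \<or> l = 2 * m - 4 \<or> l = 2 * m - 2"
      | "w = (l, True)" "odd l" "l \<le> 2 * m - 3"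
    proof (cases s)
      case True
      then show ?thesis using assms Pair that(2) by auto
    next
      case False
      then have "l \<le> 2 * m - 4 \<and> l \<noteq> 2 * m - 5 \<or> l = 2 * m - 2" using assms Pair by auto
      then have "l \<le> 2 * m - 6 \<or> l = 2 * m - 4 \<or> l = 2 * m - 2" by linarith
      then show ?thesis using False Pair by (intro that(1)) auto
    qed
    then show ?thesis
    proof cases
      case 1
      then show ?thesis using H by simp
    next
      case 2
      have "l - 3 \<le> 2 * m - 6" "l - 4 \<le> 2 * m - 6" using 2 by auto
      moreover have "l - 1 \<le> 2 * m - 6 \<or> l - 1 = 2 * m - 4" using 2 by presburger
      ultimately have "vertex_letter (2 * m + 1, True) * vertex_letter (l, True)
          = vertex_letter (l, True) * vertex_letter (2 * m + 1, True)"
        by (intro bar_commute H[symmetric]) auto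
      then show ?thesis using 2 by simp
    qed
  qed
qed

lemma transfer_even:
  "transfer (2 * m) = transfer (2 * m - 1) + h (2 * m) * transfer (2 * m - 3)
    + g m * h (2 * m - 2) * h (2 * m - 3) * h (2 * m)
      * (transfer (2 * m - 4) - h (2 * m - 5) * transfer (2 * m - 8) + h (2 * m - 2) * transfer (2 * m - 6))"
proof -
  consider "m \<le> 0" | "m = 1" | "2 \<le> m" by linarith
  then show ?thesis
  proof cases
    case 1
    then show ?thesis by (simp add: transfer_nonpos h_nonpos)
  next
    case 2
    \<comment> \<open>Size two has no barred vertex, and the barred term of the recursion vanishes
      since \<open>h 0 = 0\<close>.\<close>
    then show ?thesis using insert_even[of 1] by (simp add: h_nonpos graph_two transfer_def)
  next
    case 3
    have "transfer (2 * m) = indep_sum vertex_letter (insert (2 * m, False) (graph (2 * m - 1)))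
      + vertex_letter (2 * m + 1, True) * indep_sum vertex_letter
        (insert (2 * m - 2, False) (graph (2 * m - 4) - {(2 * m - 5, False)}))"
      unfolding transfer_def graph_even[OF 3]
      by (rule indep_sum_insert[OF _ _ nonneighbours_bar[OF 3]]; (rule bar_letter_commute)?) auto
    moreover have "(2 * m + 1) div 2 = m" by simp
    ultimately show ?thesis by (simp add: insert_even inner_sum[OF 3])
  qed
qed

lemma transfer_rec:
  "transfer (2 * m) = transfer (2 * (m - 1)) + h (2 * m - 1) * transfer (2 * (m - 2))
    + h (2 * m) * (transfer (2 * (m - 2)) + h (2 * m - 3) * transfer (2 * (m - 3)))
    + g m * h (2 * m - 2) * h (2 * m - 3) * h (2 * m)
      * (transfer (2 * (m - 2)) - h (2 * m - 5) * transfer (2 * (m - 4)) + h (2 * m - 2) * transfer (2 * (m - 3)))"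
  using transfer_even[of m] transfer_odd[of m] transfer_odd[of "m - 1"] by (simp add: right_diff_distrib)

end

section \<open>The inversion formula\<close>

lemma prod_list_central_factor:
  fixes c :: "'a::monoid_mult"
  assumes "\<And>z. z * c = c * z"
  shows "prod_list (map (\<lambda>v. c * f v) xs) = c ^ length xs * prod_list (map f xs)"
proof (induction xs)
  case (Cons x xs)
  have "f x * c ^ length xs = c ^ length xs * f x"
    by (rule power_commuting_commutes[OF assms[symmetric], symmetric])
  then have "f x * (c ^ length xs * z) = c ^ length xs * (f x * z)" for z
    by (metis mult.assoc)
  with Cons show ?case by (simp add: mult.assoc)
qed simp

section \<open>The concrete model with centrally embedded scalars\<close>

locale claw_model =
  fixes emb :: "complex \<Rightarrow> 'a::ring_1" and h :: "nat \<Rightarrow> 'a" and b :: "nat \<Rightarrow> complex"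
    and M :: nat and beta3 beta5 :: complex
  assumes emb_one: "emb 1 = 1"
    and emb_add: "emb (x + y) = emb x + emb y"
    and emb_mult: "emb (x * y) = emb x * emb y"
    and emb_central: "emb c * a = a * emb c"
    and sq: "1 \<le> m \<Longrightarrow> m \<le> M \<Longrightarrow> h m * h m = emb ((b m)\<^sup>2)"
    and anti1: "1 \<le> m \<Longrightarrow> m + 1 \<le> M \<Longrightarrow> h m * h (m + 1) = - (h (m + 1) * h m)"
    and anti2: "1 \<le> m \<Longrightarrow> m + 2 \<le> M \<Longrightarrow> h m * h (m + 2) = - (h (m + 2) * h m)"
    and comm: "1 \<le> m \<Longrightarrow> m + 2 < l \<Longrightarrow> l \<le> M \<Longrightarrow> h m * h l = h l * h m"
begin

abbreviation "bb \<equiv> ext_b M b"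
abbreviation "eh \<equiv> ext_h M h"
abbreviation "gam m \<equiv> beta_odd bb beta3 beta5 (2 * m - 1)"
abbreviation "bar m \<equiv> bar_b M bb beta3 beta5 (2 * m + 1)"
definition "H u i = emb (- u) * eh i"
text \<open>The three letters of a barred vertex carry \<open>(- u) ^ 3\<close>; dividing by
  \<open>u\<^sup>2\<close> leaves the single \<open>- u\<close> that a vertex should have. At
  \<open>u = 0\<close> the quotient is 0, and all letters vanish.\<close>

definition "G u m = emb (gam m / u\<^sup>2)"

lemma emb_zero: "emb 0 = 0"
  using emb_add[of 0 0] by simp

lemma emb_minus: "emb (- x) = - emb x"
  using emb_add[of x "- x"] by (simp add: emb_zero eq_neg_iff_add_eq_0 add.commute)

lemma emb_diff: "emb (x - y) = emb x - emb y"
  using emb_add[of x "- y"] by (simp add: emb_minus)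

lemma emb_power: "emb (x ^ n) = emb x ^ n"
  by (induction n) (simp_all add: emb_one emb_mult)

lemmas emb_fold = emb_mult[symmetric] emb_add[symmetric] emb_diff[symmetric]

lemma emb_left: "z * (emb c * w) = emb c * (z * w)"
  using emb_central by (metis mult.assoc)

lemma eh_sq: "eh i * eh i = emb ((bb i)\<^sup>2)"
  unfolding ext_h_def ext_b_def using sq[of "nat i"] by (auto simp: emb_zero)

lemma eh_anti1: "eh i * eh (i + 1) = - (eh (i + 1) * eh i)"
  unfolding ext_h_def using anti1[of "nat i"] by (auto simp: nat_add_distrib)

lemma eh_anti2: "eh i * eh (i + 2) = - (eh (i + 2) * eh i)"
  unfolding ext_h_def using anti2[of "nat i"] by (auto simp: nat_add_distrib)

lemma eh_comm: "i + 2 < j \<Longrightarrow> eh i * eh j = eh j * eh i"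
  unfolding ext_h_def using comm[of "nat i" "nat j"] by auto

lemma H_uminus: "H (- u) = (\<lambda>i. - H u i)"
  unfolding H_def by (simp add: emb_minus)

lemma G_uminus: "G (- u) = G u"
  unfolding G_def by simp

lemma H_mult: "H u i * H u j = emb (u\<^sup>2) * (eh i * eh j)"
  unfolding H_def by (simp add: mult.assoc emb_left[of "eh i"] power2_eq_square emb_mult emb_minus)

lemma H_sq: "H u i * H u i = emb (u\<^sup>2 * (bb i)\<^sup>2)"
  unfolding H_mult eh_sq emb_mult ..

lemma letters: "chain_letters (H u) (G u)"
proof
  show "z * (H u i * H u i) = H u i * H u i * z" for z i
    unfolding H_sq by (rule emb_central[symmetric])
  show "z * G u m = G u m * z" for z m
    unfolding G_def by (rule emb_central[symmetric])
  show "H u i * H u (i + 1) = - (H u (i + 1) * H u i)" for i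
    unfolding H_mult eh_anti1[of i] by simp
  show "H u i * H u (i + 2) = - (H u (i + 2) * H u i)" for i
    unfolding H_mult eh_anti2[of i] by simp
  show "H u i * H u j = H u j * H u i" if "i + 2 < j" for i j
    unfolding H_mult eh_comm[OF that] ..
qed (simp add: H_def ext_h_def)

text \<open>Powers of \<open>- u\<close> are central, so each vertex receives one factor; the sum
  over the size \<open>k\<close> then merges into one sum over independent sets.\<close>

lemma T_indep_sum:
  "T emb M h b beta3 beta5 j u
    = indep_sum (\<lambda>v. emb (- u) * vertex_op emb M h b beta3 beta5 v) (graph (int j))"
proof -
  let ?V = "graph (int j)"
  let ?I = "{S. S \<subseteq> ?V \<and> independent S}"
  let ?f = "vertex_op emb M h b beta3 beta5"
  let ?p = "\<lambda>S. prod_list (map (\<lambda>v. emb (- u) * ?f v) (sorted_list_of_set S))"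
  have V: "vertices j = ?V"
    by (simp add: vertices_def graph_def)
  have p: "?p S = emb ((- u) ^ card S) * prod_list (map ?f (sorted_list_of_set S))" for S
    by (subst prod_list_central_factor[OF emb_central[symmetric]]) (simp add: emb_power)
  have "T emb M h b beta3 beta5 j u = (\<Sum>k \<le> card ?V. \<Sum>S \<in> {S \<in> ?I. card S = k}. ?p S)"
    unfolding T_def Q_def V sum_distrib_left
    by (intro sum.cong refl) (auto simp: p)
  also have "\<dots> = sum ?p ?I"
    by (rule sum.group) (auto intro: card_mono)
  finally show ?thesis unfolding indep_sum_def .
qed

lemma T_transfer:
  "T emb M h b beta3 beta5 j u = chain_letters.transfer (H u) (G u) (int j)"
proof -
  interpret chain_letters "H u" "G u" by (rule letters)
  have "vertex_letter v = emb (- u) * vertex_op emb M h b beta3 beta5 v" if "v \<in> graph (int j)" for v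
  proof (cases v)
    case (Pair n s)
    show ?thesis
    proof (cases s)
      case False
      then show ?thesis using Pair by (simp add: vertex_op_def H_def)
    next
      case True
      with that Pair have "2 * (n div 2) - 1 = n - 2" by (auto elim!: oddE)
      then have "gam (n div 2) = beta_odd bb beta3 beta5 (n - 2)" by (rule arg_cong)
      moreover have "emb (x / u\<^sup>2) * (emb (- u) * e1) * (emb (- u) * e2) * (emb (- u) * e3)
          = emb (- u) * (emb x * e1 * e2 * e3)" for x e1 e2 e3
      proof -
        have "emb (x / u\<^sup>2) * (emb (- u) * e1) * (emb (- u) * e2) * (emb (- u) * e3)
            = emb (x / u\<^sup>2 * (- u * (- u * - u))) * (e1 * e2 * e3)"
          by (simp only: emb_mult mult.assoc emb_left[of e1] emb_left[of e2])
        also have "x / u\<^sup>2 * (- u * (- u * - u)) = - u * x"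
          by (simp add: power2_eq_square)
        finally show ?thesis by (simp only: emb_mult mult.assoc)
      qed
      ultimately show ?thesis
        using Pair True by (simp add: vertex_op_def H_def G_def)
    qed
  qed
  then show ?thesis
    unfolding T_indep_sum transfer_def by (intro indep_sum_cong) auto
qed

text \<open>If the range condition in \<open>bar_b\<close> fails, one of the factors
  \<open>bb\<close> is already zero.\<close>

lemma bar_eq: "bar m = gam m * bb (2 * m - 2) * bb (2 * m - 3) * bb (2 * m)"
  unfolding bar_b_def by (auto simp: ext_b_def)

lemma chain:
  "operator_chain (H u) (G u) (\<lambda>m. chain_letters.transfer (H u) (G u) (2 * m))
    (\<lambda>m. chain_letters.transfer (H (- u)) (G (- u)) (2 * m))"
proof -
  interpret L: chain_letters "H u" "G u" by (rule letters)
  interpret R: chain_letters "H (- u)" "G (- u)" by (rule letters)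
  show ?thesis
  proof
    show "L.transfer (2 * m) = 1" "R.transfer (2 * m) = 1" if "m \<le> 0" for m
      by (rule L.transfer_nonpos R.transfer_nonpos, use that in simp)+
    show "L.transfer (2 * m) = L.transfer (2 * (m - 1)) + H u (2 * m - 1) * L.transfer (2 * (m - 2))
      + H u (2 * m) * (L.transfer (2 * (m - 2)) + H u (2 * m - 3) * L.transfer (2 * (m - 3)))
      + G u m * H u (2 * m - 2) * H u (2 * m - 3) * H u (2 * m)
        * (L.transfer (2 * (m - 2)) - H u (2 * m - 5) * L.transfer (2 * (m - 4))
          + H u (2 * m - 2) * L.transfer (2 * (m - 3)))" for m
      by (rule L.transfer_rec)
    show "R.transfer (2 * m) = R.transfer (2 * (m - 1)) - H u (2 * m - 1) * R.transfer (2 * (m - 2))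
      - H u (2 * m) * (R.transfer (2 * (m - 2)) - H u (2 * m - 3) * R.transfer (2 * (m - 3)))
      - G u m * H u (2 * m - 2) * H u (2 * m - 3) * H u (2 * m)
        * (R.transfer (2 * (m - 2)) + H u (2 * m - 5) * R.transfer (2 * (m - 4))
          - H u (2 * m - 2) * R.transfer (2 * (m - 3)))" for m
      \<comment> \<open>Passing to \<open>- u\<close> negates every letter and fixes
        \<open>G\<close>, so the product of three letters changes sign too.\<close>
      using R.transfer_rec[of m] by (simp add: H_uminus G_uminus)
  qed
qed

lemma bar_sq:
  fixes u :: complex
  defines "d \<equiv> \<lambda>m. G u m * H u (2 * m - 2) * H u (2 * m - 3) * H u (2 * m)"
  shows "d m * d m = emb (u\<^sup>2 * (bar m)\<^sup>2)"
proof -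
  interpret chain_letters "H u" "G u" by (rule letters)
  let ?A = "H u (2 * m - 2)" and ?B = "H u (2 * m - 3)" and ?C = "H u (2 * m)"
  have "?B * ?A = - (?A * ?B)" "?C * ?A = - (?A * ?C)"
    by (rule anti; simp)+
  moreover have "?C * ?B = ?B * ?C"
    by (rule comm') simp
  \<comment> \<open>Sorting the product takes two anticommutations, so no sign is left.\<close>
  ultimately have "?A * ?B * ?C * (?A * ?B * ?C) = (?A * ?A) * (?B * ?B) * (?C * ?C)"
  proof -
    fix A B C :: 'a assume r: "B * A = - (A * B)" "C * A = - (A * C)" "C * B = B * C"
    show "A * B * C * (A * B * C) = (A * A) * (B * B) * (C * C)"
      by (simp add: mult.assoc r r[THEN rewrite_prefix])
  qed
  moreover have "d m * d m = G u m * G u m * (?A * ?B * ?C * (?A * ?B * ?C))"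
    unfolding d_def by (simp add: mult.assoc g_left[of ?A] g_left[of ?B] g_left[of ?C])
  ultimately have "d m * d m = G u m * G u m * ((?A * ?A) * (?B * ?B) * (?C * ?C))"
    by simp
  also have "\<dots> = emb ((gam m / u\<^sup>2)\<^sup>2 * (u\<^sup>2 * (bb (2 * m - 2))\<^sup>2 * (u\<^sup>2 * (bb (2 * m - 3))\<^sup>2)
      * (u\<^sup>2 * (bb (2 * m))\<^sup>2)))"
    unfolding H_sq G_def by (simp only: emb_fold power2_eq_square)
  also have "(gam m / u\<^sup>2)\<^sup>2 * (u\<^sup>2 * (bb (2 * m - 2))\<^sup>2 * (u\<^sup>2 * (bb (2 * m - 3))\<^sup>2)
      * (u\<^sup>2 * (bb (2 * m))\<^sup>2)) = u\<^sup>2 * (bar m)\<^sup>2"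
    unfolding bar_eq by (cases "u = 0") (simp_all add: field_simps power2_eq_square)
  finally show ?thesis .
qed

lemma kappa_eq: "1 + G u m * H u i * H u i = emb (1 + gam m / u\<^sup>2 * (u\<^sup>2 * (bb i)\<^sup>2))"
  by (simp only: mult.assoc[of _ "H u i"] H_sq G_def emb_add emb_mult emb_one)

section \<open>Comparison with the polynomials\<close>

declare Ppoly.simps [simp del]

lemma even_case:
  "chain_letters.transfer (H u) (G u) (2 * m) * chain_letters.transfer (H (- u)) (G (- u)) (2 * m)
    = emb (poly (Ppoly M b beta3 beta5 (nat (2 * m))) (u\<^sup>2))"
proof (induction "nat m" arbitrary: m rule: less_induct)
  case less
  interpret operator_chain "H u" "G u" "\<lambda>m. chain_letters.transfer (H u) (G u) (2 * m)"
    "\<lambda>m. chain_letters.transfer (H (- u)) (G (- u)) (2 * m)"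
    by (rule chain)
  define p where "p n = poly (Ppoly M b beta3 beta5 (nat (2 * n))) (u\<^sup>2)" for n
  show ?case
  proof (cases "m \<le> 0")
    case True
    then show ?thesis using t_init[of m] tb_init[of m] by (simp add: Ppoly.simps[of _ _ _ _ 0] emb_one)
  next
    case False
    have IH: "chain_letters.transfer (H u) (G u) (2 * n) * chain_letters.transfer (H (- u)) (G (- u)) (2 * n)
      = emb (p n)" if "n < m" for n
      unfolding p_def using that False by (intro less.hyps) auto
    have P: "Ppoly M b beta3 beta5 (nat (2 * m)) =
        Ppoly M b beta3 beta5 (nat (2 * (m - 1)))
        - [:0, 1:] * smult ((bb (2 * m - 1))\<^sup>2 + (bb (2 * m))\<^sup>2 + (bar m)\<^sup>2)
            (Ppoly M b beta3 beta5 (nat (2 * (m - 2))))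
        + [:0, 1:] ^ 2 * smult ((bb (2 * m - 3))\<^sup>2 * (bb (2 * m))\<^sup>2 * (1 + gam m * (bb (2 * m - 2))\<^sup>2)\<^sup>2)
            (Ppoly M b beta3 beta5 (nat (2 * (m - 3))))
        - [:0, 1:] ^ 2 * smult ((bb (2 * m - 5))\<^sup>2 * (bar m)\<^sup>2)
            (Ppoly M b beta3 beta5 (nat (2 * (m - 4))))"
    proof -
      \<comment> \<open>Truncation sends negative indices to 0, where the polynomial is 1, in accord
        with the transfer matrices of nonpositive size.\<close>
      have "nat (2 * m) \<noteq> 0" "even (nat (2 * m))" "int (nat (2 * m)) = 2 * m"
        "nat (2 * m) - 2 = nat (2 * (m - 1))" "nat (2 * m) - 4 = nat (2 * (m - 2))"
        "nat (2 * m) - 6 = nat (2 * (m - 3))" "nat (2 * m) - 8 = nat (2 * (m - 4))"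
        using False by (auto simp: even_nat_iff)
      then show ?thesis
        by (subst Ppoly.simps) (simp only: if_True if_False not_True_eq_False)
    qed
    have "chain_letters.transfer (H u) (G u) (2 * m) * chain_letters.transfer (H (- u)) (G (- u)) (2 * m)
      = emb (p (m - 1))
        - (emb (u\<^sup>2 * (bb (2 * m - 1))\<^sup>2) + emb (u\<^sup>2 * (bb (2 * m))\<^sup>2) + emb (u\<^sup>2 * (bar m)\<^sup>2)) * emb (p (m - 2))
        + emb (1 + gam m / u\<^sup>2 * (u\<^sup>2 * (bb (2 * m - 2))\<^sup>2)) * emb (1 + gam m / u\<^sup>2 * (u\<^sup>2 * (bb (2 * m - 2))\<^sup>2))
          * emb (u\<^sup>2 * (bb (2 * m))\<^sup>2) * emb (u\<^sup>2 * (bb (2 * m - 3))\<^sup>2) * emb (p (m - 3))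
        - emb (u\<^sup>2 * (bar m)\<^sup>2) * emb (u\<^sup>2 * (bb (2 * m - 5))\<^sup>2) * emb (p (m - 4))"
      unfolding t_tb[of m] d_def k_def bar_sq kappa_eq H_sq by (simp only: IH)
    also have "\<dots> = emb (p (m - 1)
        - (u\<^sup>2 * (bb (2 * m - 1))\<^sup>2 + u\<^sup>2 * (bb (2 * m))\<^sup>2 + u\<^sup>2 * (bar m)\<^sup>2) * p (m - 2)
        + (1 + gam m / u\<^sup>2 * (u\<^sup>2 * (bb (2 * m - 2))\<^sup>2)) * (1 + gam m / u\<^sup>2 * (u\<^sup>2 * (bb (2 * m - 2))\<^sup>2))
          * (u\<^sup>2 * (bb (2 * m))\<^sup>2) * (u\<^sup>2 * (bb (2 * m - 3))\<^sup>2) * p (m - 3)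
        - u\<^sup>2 * (bar m)\<^sup>2 * (u\<^sup>2 * (bb (2 * m - 5))\<^sup>2) * p (m - 4))"
      by (simp only: emb_fold)
    also have "\<dots> = emb (p m)"
      \<comment> \<open>The division by \<open>u\<^sup>2\<close> cancels only for nonzero
        \<open>u\<close>; at \<open>u = 0\<close> every term but the first carries a zero factor
        \<open>u\<^sup>2\<close>.\<close>
      unfolding p_def P by (rule arg_cong[of _ _ emb], cases "u = 0") (simp_all add: algebra_simps power2_eq_square)
    finally show ?thesis unfolding p_def .
  qed
qed

lemma T_mult_T:
  "T emb M h b beta3 beta5 j u * T emb M h b beta3 beta5 j (- u) = emb (poly (Ppoly M b beta3 beta5 j) (u\<^sup>2))"
proof (cases "even j")
  case True
  then obtain n where "j = 2 * n" by (rule evenE)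
  then show ?thesis using even_case[of u "int n"] by (simp add: T_transfer nat_mult_distrib)
next
  case False
  define m where "m = (int j + 1) div 2"
  with False have j: "int j = 2 * m - 1" "1 \<le> m" by (auto elim!: oddE)
  interpret L: chain_letters "H u" "G u" by (rule letters)
  interpret R: chain_letters "H (- u)" "G (- u)" by (rule letters)
  interpret operator_chain "H u" "G u" "\<lambda>m. L.transfer (2 * m)" "\<lambda>m. R.transfer (2 * m)"
    by (rule chain)
  define p where "p n = poly (Ppoly M b beta3 beta5 (nat (2 * n))) (u\<^sup>2)" for n
  have "L.transfer (2 * m - 1) = L.transfer (2 * (m - 1)) + H u (2 * m - 1) * L.transfer (2 * (m - 2))"
    using L.transfer_odd[of m] by (simp add: right_diff_distrib)
  moreover have "R.transfer (2 * m - 1) = R.transfer (2 * (m - 1)) - H u (2 * m - 1) * R.transfer (2 * (m - 2))"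
    using R.transfer_odd[of m] by (simp add: right_diff_distrib H_uminus)
  ultimately have "L.transfer (2 * m - 1) * R.transfer (2 * m - 1)
      = emb (p (m - 1)) - emb (u\<^sup>2 * (bb (2 * m - 1))\<^sup>2) * emb (p (m - 2))"
    unfolding p_def even_case[symmetric] H_sq[symmetric] by (simp only: t_tb_odd)
  also have "\<dots> = emb (p (m - 1) - u\<^sup>2 * (bb (2 * m - 1))\<^sup>2 * p (m - 2))"
    by (simp only: emb_fold)
  also have "p (m - 1) - u\<^sup>2 * (bb (2 * m - 1))\<^sup>2 * p (m - 2) = poly (Ppoly M b beta3 beta5 j) (u\<^sup>2)"
  proof -
    have "j \<noteq> 0" "j - 1 = nat (2 * (m - 1))" "j - 3 = nat (2 * (m - 2))"
      using j odd_pos[OF False] by auto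
    with False have "Ppoly M b beta3 beta5 j = Ppoly M b beta3 beta5 (nat (2 * (m - 1)))
      - [:0, 1:] * smult ((bb (int j))\<^sup>2) (Ppoly M b beta3 beta5 (nat (2 * (m - 2))))"
      by (subst Ppoly.simps) (simp only: if_False)
    then show ?thesis unfolding p_def by (simp add: j)
  qed
  finally show ?thesis unfolding T_transfer j(1) .
qed

end

theorem theorem3:
  fixes emb :: "complex \<Rightarrow> 'a::ring_1" and h :: "nat \<Rightarrow> 'a" and b :: "nat \<Rightarrow> complex"
    and M j :: nat and beta3 beta5 u :: complex
  assumes emb_one: "emb 1 = 1"
    and emb_add: "\<forall>x y. emb (x + y) = emb x + emb y"
    and emb_mult: "\<forall>x y. emb (x * y) = emb x * emb y"
    and emb_central: "\<forall>c a. emb c * a = a * emb c"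
    and sq: "\<forall>m. 1 \<le> m \<and> m \<le> M \<longrightarrow> h m * h m = emb ((b m)\<^sup>2)"
    and anti1: "\<forall>m. 1 \<le> m \<and> m + 1 \<le> M \<longrightarrow> h m * h (m + 1) = - (h (m + 1) * h m)"
    and anti2: "\<forall>m. 1 \<le> m \<and> m + 2 \<le> M \<longrightarrow> h m * h (m + 2) = - (h (m + 2) * h m)"
    and comm: "\<forall>m l. 1 \<le> m \<and> m \<le> M \<and> 1 \<le> l \<and> l \<le> M \<and> (m + 2 < l \<or> l + 2 < m)
                 \<longrightarrow> h m * h l = h l * h m"
    and denom: "\<forall>m::nat. 3 \<le> m \<longrightarrow>
        (ext_b M b (2 * int m - 4))\<^sup>2 * beta_seq (ext_b M b) beta3 beta5 (m - 2)
        - (ext_b M b (2 * int m))\<^sup>2 * beta_seq (ext_b M b) beta3 beta5 (m - 1) + 1 \<noteq> 0"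
    and j: "1 \<le> j" "j \<le> M"
  shows "T emb M h b beta3 beta5 j u * T emb M h b beta3 beta5 j (- u)
           = emb (poly (Ppoly M b beta3 beta5 j) (u\<^sup>2))"
proof -
  interpret claw_model emb h b M beta3 beta5
  proof
    show "emb c * a = a * emb c" for c a using emb_central by blast
  qed (use emb_one emb_add emb_mult sq anti1 anti2 comm in auto)
  show ?thesis by (rule T_mult_T)
qed

end
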